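(* Let $\alpha\in\mathbb R\setminus\{0\}$. For $\varepsilon\in\mathbb R\setminus\{0\}$ define $T_\varepsilon:L^2(\mu)\to L^2(\mu_\alpha)$ by $$T_\varepsilon f(s)=\int_{\mathbb R}\frac{f(t)}{s-t+i\varepsilon}\,d\mu(t).$$ Then the operators $T_\varepsilon$ are bounded uniformly in $\varepsilon$: $\sup_{\varepsilon\ne0}\|T_\varepsilon\|_{L^2(\mu)\to L^2(\mu_\alpha)}<\infty$.
   Context: Let $\mu$ be a nonzero positive Borel measure on $\mathbb R$ with $\int_{\mathbb R}(1+|t|)^{-1}\,d\mu(t)<\infty$, and $F(\lambda)=\int_{\mathbb R}\frac{d\mu(t)}{t-\lambda}$ for $\lambda\in\mathbb C\setminus\mathbb R$. For $\alpha\in\mathbb R$, $\mu_\alpha$ denotes the unique positive Borel measure on $\mathbb R$ with $\int_{\mathbb R}\frac{d\mu_\alpha(s)}{s-\lambda}=\frac{F(\lambda)}{1+\alpha F(\lambda)}$ for all $\lambda\notin\mathbb R$; it is the spectral measure, with respect to $\mathbf 1$, of the rank one perturbation $A_\alpha=M_t+\alpha(\,\cdot\,,\mathbf 1)\mathbf 1$ of multiplication by $t$ on $L^2(\mu)$. *)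

theory Defs
  imports "HOL-Analysis.Analysis"
begin

definition cauchy_transform :: "real measure \<Rightarrow> complex \<Rightarrow> complex" where
  "cauchy_transform M z = (\<integral>t. 1 / (complex_of_real t - z) \<partial>M)"

text \<open>mu_alpha: a positive Borel measure whose Cauchy transform is F/(1+alpha F) off the real axis
  (such a measure is unique, so any measure with this property is the mu_alpha of the paper).\<close>
definition is_perturbed_measure :: "real measure \<Rightarrow> real \<Rightarrow> real measure \<Rightarrow> bool" where
  "is_perturbed_measure M \<alpha> N \<longleftrightarrow>
     sets N = sets borel \<and>
     (\<forall>z. Im z \<noteq> 0 \<longrightarrow>
        integrable N (\<lambda>s. 1 / (complex_of_real s - z)) \<and>
        cauchy_transform N z = cauchy_transform M z / (1 + complex_of_real \<alpha> * cauchy_transform M z))"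

definition T_op :: "real measure \<Rightarrow> real \<Rightarrow> (real \<Rightarrow> complex) \<Rightarrow> real \<Rightarrow> complex" where
  "T_op M \<epsilon> f s = (\<integral>t. f t / (complex_of_real s - complex_of_real t + \<i> * complex_of_real \<epsilon>) \<partial>M)"

end

theory Submission
  imports Defs
begin

text \<open>
  Let $V$ be the unitary operator from $L^2(\mu)$ to $L^2(\mu_\alpha)$ that sends $1/(t-z)$ to
  $(1+\alpha F(z))/(s-z)$. For a unimodular function $c$ the commutator $c\,V\bar c-V$ has the
  integral kernel $\alpha\,(c(s)\overline{c(t)}-1)/(s-t)$, which for the Cayley transform
  $c(t)=(1+iht)/(1-iht)$ is of rank one. Hence the Abel means
  $(1-a)\sum_n a^n c^n\,V\,\bar c^n$ with $0<a<1$ are contractions of the form $V+\alpha K$, and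
  so $\|K\|\le 2/|\alpha|$. With $a=1-2h\varepsilon$ the kernel of $K$ tends to
  $-1/(s-t+i\varepsilon)$ as $h\to 0$.

  Only the restriction of $V$ to the span $D$ of the resolvents $1/(t-z)$ is needed, since
  $T_\varepsilon$ vanishes on the orthogonal complement of $D$.
\<close>

section \<open>Square-integrable complex functions\<close>

text \<open>On a resolvent, V acts as V f(s) = f(s) - \<alpha> times the integral of (f(s) -
  f(t))/(s - t) in t. In c V conj(c) - V the terms with f(s) cancel because |c| = 1; this is the
  origin of the commutator kernel. For small h the function c(t) is close to e^(2iht), so for eps >
  0 and a = 1 - 2h eps the Abel means discretise the integral over x > 0 of eps e^(-eps x)
  (e^(ix(s-t)) - 1)/(s - t), whose value is -1/(s - t + i eps). The Cayley transform stands in for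
  the exponential because it is rational: away from one pole, multiplication by its conjugate keeps
  the span of the resolvents.

  The Abel series is never summed. Its sum S = V + \<alpha>K satisfies S = (1 - a) V + a c S
  conj(c), and V is isometric, so a bound C for S improves to a C + (1 - a). Iteration from a crude
  bound, which may depend on h and a, leads to the bound 1.\<close>

definition L2 :: "'a measure \<Rightarrow> ('a \<Rightarrow> complex) \<Rightarrow> bool" where
  "L2 M f \<longleftrightarrow> f \<in> borel_measurable M \<and> integrable M (\<lambda>t. (cmod (f t))\<^sup>2)"

definition L2_norm :: "'a measure \<Rightarrow> ('a \<Rightarrow> complex) \<Rightarrow> real" where
  "L2_norm M f = sqrt (\<integral>t. (cmod (f t))\<^sup>2 \<partial>M)"

definition L2_inner :: "'a measure \<Rightarrow> ('a \<Rightarrow> complex) \<Rightarrow> ('a \<Rightarrow> complex) \<Rightarrow> complex" where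
  "L2_inner M f g = (\<integral>t. f t * cnj (g t) \<partial>M)"

lemma borel_measurable_cnj [measurable (raw)]:
  "f \<in> borel_measurable M \<Longrightarrow> (\<lambda>x. cnj (f x)) \<in> borel_measurable M"
  by (rule borel_measurable_continuous_on[where f = cnj, OF continuous_on_cnj[OF continuous_on_id]])

lemma L2_measurable [measurable_dest]: "L2 M f \<Longrightarrow> f \<in> borel_measurable M"
  by (simp add: L2_def)

lemma L2_norm_nonneg [simp]: "0 \<le> L2_norm M f"
  by (simp add: L2_norm_def)

lemma L2_norm_power2: "(L2_norm M f)\<^sup>2 = (\<integral>t. (cmod (f t))\<^sup>2 \<partial>M)"
  by (simp add: L2_norm_def)

lemma L2_integrable_mult:
  assumes "L2 M f" "L2 M g"
  shows "integrable M (\<lambda>t. f t * g t)"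
proof (rule Bochner_Integration.integrable_bound)
  show "integrable M (\<lambda>t. (cmod (f t))\<^sup>2 + (cmod (g t))\<^sup>2)"
    using assms by (simp add: L2_def)
  show "(\<lambda>t. f t * g t) \<in> borel_measurable M"
    using assms by (auto simp: L2_def)
  have "cmod (f t * g t) \<le> norm ((cmod (f t))\<^sup>2 + (cmod (g t))\<^sup>2)" for t
  proof -
    have "2 * cmod (f t) * cmod (g t) \<le> (cmod (f t))\<^sup>2 + (cmod (g t))\<^sup>2"
      by (rule sum_squares_bound)
    moreover have "0 \<le> cmod (f t) * cmod (g t)" by simp
    ultimately show ?thesis
      unfolding norm_mult real_norm_def by linarith
  qed
  then show "AE t in M. cmod (f t * g t) \<le> norm ((cmod (f t))\<^sup>2 + (cmod (g t))\<^sup>2)"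
    by simp
qed

lemma L2_cnj: "L2 M f \<Longrightarrow> L2 M (\<lambda>t. cnj (f t))"
  by (auto simp: L2_def)

lemma L2_cmult: "L2 M f \<Longrightarrow> L2 M (\<lambda>t. c * f t)"
  by (auto simp: L2_def norm_mult power_mult_distrib)

lemma L2_zero: "L2 M (\<lambda>t. 0)"
  by (simp add: L2_def)

lemma L2_add:
  assumes "L2 M f" "L2 M g"
  shows "L2 M (\<lambda>t. f t + g t)"
  unfolding L2_def
proof
  have int: "integrable M (\<lambda>t. (cmod (f t))\<^sup>2 + (cmod (g t))\<^sup>2 + 2 * Re (f t * cnj (g t)))"
    using assms by (intro Bochner_Integration.integrable_add integrable_mult_right integrable_Re
        L2_integrable_mult L2_cnj) (simp_all add: L2_def)
  have "(cmod (f t))\<^sup>2 + (cmod (g t))\<^sup>2 + 2 * Re (f t * cnj (g t)) = (cmod (f t + g t))\<^sup>2" for t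
    unfolding cmod_power2 by (simp add: algebra_simps power2_eq_square)
  then show "integrable M (\<lambda>t. (cmod (f t + g t))\<^sup>2)"
    using int by simp
qed (use assms in \<open>auto simp: L2_def\<close>)

lemma L2_diff:
  assumes "L2 M f" "L2 M g"
  shows "L2 M (\<lambda>t. f t - g t)"
  using L2_add[OF assms(1) L2_cmult[OF assms(2), of "-1"]] by simp

lemma L2_norm_cmult: "L2_norm M (\<lambda>t. c * f t) = cmod c * L2_norm M f"
  by (simp add: L2_norm_def norm_mult power_mult_distrib real_sqrt_mult)

lemma L2_norm_cong: "(\<And>t. cmod (f t) = cmod (g t)) \<Longrightarrow> L2_norm M f = L2_norm M g"
  by (simp add: L2_norm_def)

lemma L2_norm_zero [simp]: "L2_norm M (\<lambda>t. 0) = 0"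
  by (simp add: L2_norm_def)

lemma L2_inner_self: "L2_inner M f f = complex_of_real ((L2_norm M f)\<^sup>2)"
  unfolding L2_inner_def L2_norm_power2 complex_norm_square[symmetric]
  by (rule integral_complex_of_real)

text \<open>The free scalar \<open>c\<close> lets one expansion serve the Cauchy-Schwarz inequality,
  the triangle inequality (\<open>c\<close> = -1) and the variational estimate in
  \<open>almost_projection\<close>.\<close>

lemma L2_norm_diff_power2:
  assumes "L2 M f" "L2 M g"
  shows "(L2_norm M (\<lambda>t. f t - c * g t))\<^sup>2 =
           (L2_norm M f)\<^sup>2 - 2 * Re (cnj c * L2_inner M f g) + (cmod c)\<^sup>2 * (L2_norm M g)\<^sup>2"
proof -
  have int: "integrable M (\<lambda>t. f t * cnj (g t))"
    using assms by (intro L2_integrable_mult L2_cnj)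
  then have int': "integrable M (\<lambda>t. 2 * Re (cnj c * (f t * cnj (g t))))"
    by (intro integrable_mult_right integrable_Re)
  have "(cmod (f t - c * g t))\<^sup>2 = (cmod (f t))\<^sup>2 - 2 * Re (cnj c * (f t * cnj (g t)))
          + (cmod c)\<^sup>2 * (cmod (g t))\<^sup>2" for t
    unfolding cmod_power2 by (simp add: algebra_simps power2_eq_square)
  moreover have "(\<integral>t. 2 * Re (cnj c * (f t * cnj (g t))) \<partial>M) = 2 * Re (cnj c * L2_inner M f g)"
    using integral_Re[OF integrable_mult_right[OF int, of "cnj c"]]
    unfolding L2_inner_def integral_mult_right_zero by (rule arg_cong)
  ultimately show ?thesis
    using assms int' by (simp add: L2_norm_power2 L2_def)
qed

lemma L2_Cauchy_Schwarz:
  assumes "L2 M f" "L2 M g"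
  shows "cmod (L2_inner M f g) \<le> L2_norm M f * L2_norm M g"
proof -
  define A B p where "A = (L2_norm M f)\<^sup>2" and "B = (L2_norm M g)\<^sup>2" and "p = (cmod (L2_inner M f g))\<^sup>2"
  have nn: "A \<ge> 0" "B \<ge> 0" "p \<ge> 0" by (auto simp: A_def B_def p_def)
  \<comment> \<open>Moving in the direction of the inner product itself makes the cross term real,
    so a real parameter \<open>x\<close> is enough.\<close>
  have main: "0 \<le> A - 2 * (x * p) + x\<^sup>2 * p * B" for x :: real
  proof -
    let ?c = "complex_of_real x * L2_inner M f g"
    have "cnj ?c * L2_inner M f g = complex_of_real (x * p)"
      by (simp add: p_def complex_norm_square del: of_real_power)
    moreover have "(cmod ?c)\<^sup>2 = x\<^sup>2 * p"
      by (simp add: p_def norm_mult power_mult_distrib)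
    ultimately show ?thesis
      unfolding A_def B_def
      using L2_norm_diff_power2[OF assms, of ?c] zero_le_power2[of "L2_norm M (\<lambda>t. f t - ?c * g t)"]
      by (metis Re_complex_of_real)
  qed
  have "p \<le> A * B"
  proof (cases "B = 0")
    case True
    have "p = 0"
    proof (rule ccontr)
      assume "p \<noteq> 0"
      \<comment> \<open>For \<open>B\<close> = 0 the quadratic is affine in \<open>x\<close>, and
        this choice gives it the value -1.\<close>
      with main[of "(A + 1) / (2 * p)"] True nn show False by simp
    qed
    then show ?thesis using nn by simp
  next
    case False
    with nn have "B > 0" by simp
    with main[of "1 / B"] show ?thesis
      by (simp add: field_simps power2_eq_square)
  qed
  then show ?thesis
    unfolding A_def B_def p_def power_mult_distrib[symmetric]
    by (rule power2_le_imp_le) simp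
qed

lemma L2_norm_triangle:
  assumes "L2 M f" "L2 M g"
  shows "L2_norm M (\<lambda>t. f t + g t) \<le> L2_norm M f + L2_norm M g"
proof (rule power2_le_imp_le)
  have "Re (L2_inner M f g) \<le> L2_norm M f * L2_norm M g"
    using L2_Cauchy_Schwarz[OF assms] complex_Re_le_cmod order_trans by blast
  with L2_norm_diff_power2[OF assms, of "-1"]
  show "(L2_norm M (\<lambda>t. f t + g t))\<^sup>2 \<le> (L2_norm M f + L2_norm M g)\<^sup>2"
    by (simp add: power2_sum)
qed simp

lemma L2_nn_integral:
  assumes "L2 M f"
  shows "(\<integral>\<^sup>+ t. ennreal ((cmod (f t))\<^sup>2) \<partial>M) = ennreal ((L2_norm M f)\<^sup>2)"
  unfolding L2_norm_power2 using assms by (intro nn_integral_eq_integral) (auto simp: L2_def)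

lemma L2_nn_integral_iff:
  assumes "f \<in> borel_measurable M"
  shows "L2 M f \<longleftrightarrow> (\<integral>\<^sup>+ t. ennreal ((cmod (f t))\<^sup>2) \<partial>M) < \<infinity>"
  using assms by (auto simp: L2_def integrable_iff_bounded)

text \<open>Norm bounds pass to pointwise limits without convergence in norm. The bounds may vary
  with \<open>n\<close> because those in \<open>T_op_bound\<close> carry an error that tends to
  zero.\<close>

lemma L2_Fatou:
  assumes L2: "\<And>n. L2 M (g n)"
    and le: "\<And>n. L2_norm M (g n) \<le> B n"
    and B: "B \<longlonglongrightarrow> b"
    and lim: "\<And>t. (\<lambda>n. g n t) \<longlonglongrightarrow> h t"
  shows "L2 M h" "L2_norm M h \<le> b"
proof -
  have [measurable]: "h \<in> borel_measurable M"
    by (rule borel_measurable_LIMSEQ_metric[of g]) (use L2 lim in \<open>auto simp: L2_def\<close>)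
  have b: "0 \<le> b"
    by (rule LIMSEQ_le_const[OF B]) (meson L2_norm_nonneg le order_trans)
  have "(\<integral>\<^sup>+ t. ennreal ((cmod (h t))\<^sup>2) \<partial>M)
      = (\<integral>\<^sup>+ t. liminf (\<lambda>n. ennreal ((cmod (g n t))\<^sup>2)) \<partial>M)"
  proof (rule nn_integral_cong)
    fix t
    have "(\<lambda>n. ennreal ((cmod (g n t))\<^sup>2)) \<longlonglongrightarrow> ennreal ((cmod (h t))\<^sup>2)"
      by (intro tendsto_ennrealI tendsto_intros lim)
    then show "ennreal ((cmod (h t))\<^sup>2) = liminf (\<lambda>n. ennreal ((cmod (g n t))\<^sup>2))"
      by (intro lim_imp_Liminf[symmetric]) auto
  qed
  also have "\<dots> \<le> liminf (\<lambda>n. \<integral>\<^sup>+ t. ennreal ((cmod (g n t))\<^sup>2) \<partial>M)"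
    by (rule nn_integral_liminf) (use L2 in \<open>auto simp: L2_def\<close>)
  also have "\<dots> \<le> liminf (\<lambda>n. ennreal ((B n)\<^sup>2))"
    by (intro Liminf_mono always_eventually allI)
      (simp add: L2_nn_integral[OF L2] ennreal_leI power_mono[OF le])
  also have "\<dots> = ennreal (b\<^sup>2)"
    by (intro lim_imp_Liminf tendsto_ennrealI tendsto_intros B) auto
  finally have *: "(\<integral>\<^sup>+ t. ennreal ((cmod (h t))\<^sup>2) \<partial>M) \<le> ennreal (b\<^sup>2)" .
  then show "L2 M h"
    by (subst L2_nn_integral_iff) (auto simp: le_less_trans)
  then have "(L2_norm M h)\<^sup>2 \<le> b\<^sup>2"
    using * by (simp add: L2_nn_integral)
  then show "L2_norm M h \<le> b"
    using b by (rule power2_le_imp_le)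
qed

lemma L2_norm_mono:
  assumes "L2 M g" "f \<in> borel_measurable M" "\<And>t. cmod (f t) \<le> cmod (g t)"
  shows "L2 M f" "L2_norm M f \<le> L2_norm M g"
proof -
  have int: "integrable M (\<lambda>t. (cmod (f t))\<^sup>2)"
    by (rule Bochner_Integration.integrable_bound[of _ "\<lambda>t. (cmod (g t))\<^sup>2"])
      (use assms in \<open>auto simp: L2_def power_mono\<close>)
  then show "L2 M f"
    using assms by (simp add: L2_def)
  show "L2_norm M f \<le> L2_norm M g"
    unfolding L2_norm_def using assms int
    by (intro real_sqrt_le_mono integral_mono) (auto simp: L2_def power_mono)
qed

lemma L2_integral_norm_mult_le:
  assumes "L2 M f" "L2 M g"
  shows "(\<integral>t. cmod (f t * g t) \<partial>M) \<le> L2_norm M f * L2_norm M g"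
proof -
  let ?c = "\<lambda>h t. complex_of_real (cmod (h t))"
  have *: "L2 M (?c f)" "L2 M (?c g)"
    using assms by (auto simp: L2_def)
  have "L2_inner M (?c f) (?c g) = complex_of_real (\<integral>t. cmod (f t * g t) \<partial>M)"
    unfolding L2_inner_def norm_mult by (simp flip: integral_complex_of_real)
  moreover have "L2_norm M (?c f) = L2_norm M f" "L2_norm M (?c g) = L2_norm M g"
    by (auto intro: L2_norm_cong)
  ultimately show ?thesis
    using L2_Cauchy_Schwarz[OF *] by simp
qed

lemma L2_inner_add_left:
  assumes "L2 M f" "L2 M g" "L2 M h"
  shows "L2_inner M (\<lambda>t. f t + g t) h = L2_inner M f h + L2_inner M g h"
  unfolding L2_inner_def distrib_right
  using assms by (intro Bochner_Integration.integral_add L2_integrable_mult L2_cnj)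

lemma L2_inner_add_right:
  assumes "L2 M f" "L2 M g" "L2 M h"
  shows "L2_inner M h (\<lambda>t. f t + g t) = L2_inner M h f + L2_inner M h g"
  unfolding L2_inner_def distrib_left complex_cnj_add
  using assms by (intro Bochner_Integration.integral_add L2_integrable_mult L2_cnj)

lemma L2_inner_diff_left:
  assumes "L2 M f" "L2 M g" "L2 M h"
  shows "L2_inner M (\<lambda>t. f t - g t) h = L2_inner M f h - L2_inner M g h"
  unfolding L2_inner_def left_diff_distrib
  using assms by (intro Bochner_Integration.integral_diff L2_integrable_mult L2_cnj)

lemma L2_inner_cmult_left: "L2_inner M (\<lambda>t. c * f t) h = c * L2_inner M f h"
  unfolding L2_inner_def by (simp add: mult.assoc)

lemma L2_inner_cmult_right: "L2_inner M h (\<lambda>t. c * f t) = cnj c * L2_inner M h f"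
  unfolding L2_inner_def by (simp add: mult.left_commute)

section \<open>Resolvents and Cauchy transforms\<close>

definition resolvent :: "complex \<Rightarrow> real \<Rightarrow> complex" where
  "resolvent z t = 1 / (complex_of_real t - z)"

lemma cauchy_transform_resolvent: "cauchy_transform M z = (\<integral>t. resolvent z t \<partial>M)"
  by (simp add: cauchy_transform_def resolvent_def)

lemma abs_Im_le_norm_diff: "\<bar>Im z\<bar> \<le> cmod (complex_of_real t - z)"
  using abs_Im_le_cmod[of "complex_of_real t - z"] by simp

lemma of_real_neq_nonreal: "Im z \<noteq> 0 \<Longrightarrow> complex_of_real t - z \<noteq> 0"
  by (auto simp: complex_eq_iff)

lemma norm_resolvent_le: "Im z \<noteq> 0 \<Longrightarrow> cmod (resolvent z t) \<le> 1 / \<bar>Im z\<bar>"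
  unfolding resolvent_def norm_divide norm_one
  by (intro divide_left_mono abs_Im_le_norm_diff mult_pos_pos) (auto dest: of_real_neq_nonreal)

text \<open>In 1 + |t| <= (1 + |z|) + |t - z| the first summand is also at most a multiple of |t -
  z|, since |t - z| >= |Im z|. This turns the growth condition on the measure into integrability of
  the resolvents.\<close>

lemma norm_resolvent_le_growth:
  assumes "Im z \<noteq> 0"
  shows "cmod (resolvent z t) \<le> ((1 + cmod z) / \<bar>Im z\<bar> + 1) * (1 / (1 + \<bar>t\<bar>))"
proof -
  define d where "d = cmod (complex_of_real t - z)"
  have d: "\<bar>Im z\<bar> \<le> d" "d > 0"
    using abs_Im_le_norm_diff of_real_neq_nonreal[OF assms] by (auto simp: d_def)
  have "\<bar>t\<bar> \<le> cmod z + d"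
    using norm_triangle_ineq[of z "complex_of_real t - z"] by (simp add: d_def)
  moreover have "1 + cmod z \<le> (1 + cmod z) / \<bar>Im z\<bar> * d"
    using mult_left_mono[OF d(1), of "(1 + cmod z) / \<bar>Im z\<bar>"] assms by simp
  ultimately have "1 + \<bar>t\<bar> \<le> ((1 + cmod z) / \<bar>Im z\<bar> + 1) * d"
    by (simp add: algebra_simps)
  with d show ?thesis
    by (simp add: resolvent_def norm_divide flip: d_def) (simp add: field_simps)
qed

lemma cnj_resolvent: "cnj (resolvent z t) = resolvent (cnj z) t"
  by (simp add: resolvent_def)

lemma resolvent_identity:
  assumes "Im z \<noteq> 0" "Im w \<noteq> 0"
  shows "resolvent z t - resolvent w t = (z - w) * (resolvent z t * resolvent w t)"
  using of_real_neq_nonreal[OF assms(1), of t] of_real_neq_nonreal[OF assms(2), of t]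
  by (simp add: resolvent_def field_simps)

lemma borel_measurable_resolvent [measurable]: "resolvent z \<in> borel_measurable borel"
  unfolding resolvent_def by measurable

lemma tendsto_real_shift: "(\<lambda>n. z + complex_of_real (inverse (real (Suc n)))) \<longlonglongrightarrow> z"
  using tendsto_add[OF tendsto_const tendsto_of_real[OF LIMSEQ_inverse_real_of_nat], of z] by simp

text \<open>These are the properties common to the measure and its perturbation, so that
  \<open>perturbed_pair\<close> can instantiate every fact twice.\<close>

locale cauchy_measure =
  fixes M :: "real measure"
  assumes sets_M [measurable_cong]: "sets M = sets borel"
    and integrable_resolvent: "Im z \<noteq> 0 \<Longrightarrow> integrable M (resolvent z)"
begin

abbreviation F :: "complex \<Rightarrow> complex" where "F \<equiv> cauchy_transform M"

text \<open>Bilinear, without conjugation: this is the inner product of \<open>resolvent z\<close>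
  with \<open>resolvent (cnj w)\<close>. In this form it is the divided difference of
  \<open>F\<close>, so \<open>F\<close> determines all inner products of resolvents.\<close>

definition gram :: "complex \<Rightarrow> complex \<Rightarrow> complex" where
  "gram z w = (\<integral>t. resolvent z t * resolvent w t \<partial>M)"

text \<open>By Markov's inequality the sets where |resolvent| >= 1/n have finite measure, and they
  exhaust the line because a resolvent has no zero. Sigma-finiteness makes integrals with a
  parameter measurable in the parameter, as \<open>K_L2\<close> requires.\<close>

sublocale sigma_finite_measure M
proof
  let ?A = "\<lambda>n. {t \<in> space M. 1 \<le> ennreal (real n) * ennreal (cmod (resolvent \<i> t))}"
  have "emeasure M (?A n) \<noteq> \<infinity>" for n
  proof -
    have "emeasure M (?A n) \<le>
        ennreal (real n) * (\<integral>\<^sup>+ t. ennreal (cmod (resolvent \<i> t)) * indicator (space M) t \<partial>M)"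
      by (rule nn_integral_Markov_inequality) auto
    also have "(\<integral>\<^sup>+ t. ennreal (cmod (resolvent \<i> t)) * indicator (space M) t \<partial>M)
        = (\<integral>\<^sup>+ t. ennreal (cmod (resolvent \<i> t)) \<partial>M)"
      by (rule nn_integral_cong) simp
    also have "ennreal (real n) * \<dots> < \<infinity>"
      using integrable_resolvent[of \<i>] by (auto simp: integrable_iff_bounded ennreal_mult_less_top)
    finally show ?thesis by simp
  qed
  moreover have "\<exists>n. t \<in> ?A n" for t
  proof -
    have "cmod (resolvent \<i> t) > 0"
      using of_real_neq_nonreal[of \<i> t] by (simp add: resolvent_def)
    then obtain n where "1 < real n * cmod (resolvent \<i> t)"
      using reals_Archimedean3 by blast
    then have "t \<in> ?A n"
      by (simp add: ennreal_mult'[symmetric] sets_eq_imp_space_eq[OF sets_M])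
    then show ?thesis by blast
  qed
  ultimately show "\<exists>A. countable A \<and> A \<subseteq> sets M \<and> \<Union>A = space M \<and> (\<forall>a\<in>A. emeasure M a \<noteq> \<infinity>)"
    by (intro exI[of _ "range ?A"]) (auto simp: sets_eq_imp_space_eq[OF sets_M])
qed

lemma integrable_resolvent_mult:
  assumes "Im z \<noteq> 0" "Im w \<noteq> 0"
  shows "integrable M (\<lambda>t. resolvent z t * resolvent w t)"
proof (rule Bochner_Integration.integrable_bound)
  show "integrable M (\<lambda>t. (1 / \<bar>Im w\<bar>) *\<^sub>R resolvent z t)"
    using assms integrable_resolvent by simp
  show "AE t in M. cmod (resolvent z t * resolvent w t) \<le> cmod ((1 / \<bar>Im w\<bar>) *\<^sub>R resolvent z t)"
  proof (rule AE_I2)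
    fix t
    show "cmod (resolvent z t * resolvent w t) \<le> cmod ((1 / \<bar>Im w\<bar>) *\<^sub>R resolvent z t)"
      using mult_left_mono[OF norm_resolvent_le[OF assms(2)] norm_ge_zero, of "resolvent z t" t]
      by (simp add: norm_mult)
  qed
qed measurable

lemma L2_resolvent: "Im z \<noteq> 0 \<Longrightarrow> L2 M (resolvent z)"
  using integrable_norm[OF integrable_resolvent_mult[of z z]]
  by (simp add: L2_def norm_mult power2_eq_square)

lemma cauchy_transform_diff:
  assumes "Im z \<noteq> 0" "Im w \<noteq> 0"
  shows "F z - F w = (z - w) * gram z w"
proof -
  have "F z - F w = (\<integral>t. resolvent z t - resolvent w t \<partial>M)"
    unfolding cauchy_transform_resolvent using assms integrable_resolvent by simp
  then show ?thesis
    using resolvent_identity[OF assms] by (simp add: gram_def)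
qed

lemma cauchy_transform_cnj: "F (cnj z) = cnj (F z)"
  unfolding cauchy_transform_resolvent cnj_resolvent[symmetric] by simp

text \<open>The divided difference determines \<open>gram z w\<close> only for distinct arguments;
  the case \<open>z = w\<close> is reached by this limit. A real shift keeps the imaginary part,
  hence a fixed majorant.\<close>

lemma gram_real_shift:
  assumes "Im z \<noteq> 0" "Im w \<noteq> 0"
  shows "(\<lambda>n. gram z (w + complex_of_real (inverse (real (Suc n))))) \<longlonglongrightarrow> gram z w"
  unfolding gram_def
proof (rule integral_dominated_convergence)
  show "integrable M (\<lambda>t. 1 / \<bar>Im w\<bar> * cmod (resolvent z t))"
    using assms integrable_resolvent by simp
  show "AE t in M. (\<lambda>n. resolvent z t * resolvent (w + complex_of_real (inverse (real (Suc n)))) t)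
      \<longlonglongrightarrow> resolvent z t * resolvent w t"
    unfolding resolvent_def
    by (intro AE_I2 tendsto_intros tendsto_real_shift of_real_neq_nonreal assms)
  show "AE t in M. cmod (resolvent z t * resolvent (w + complex_of_real (inverse (real (Suc n)))) t)
      \<le> 1 / \<bar>Im w\<bar> * cmod (resolvent z t)" for n
    unfolding norm_mult
    by (intro AE_I2, subst mult.commute, intro mult_right_mono order_trans[OF norm_resolvent_le])
      (use assms in auto)
qed measurable

lemma cauchy_transform_real_shift:
  assumes "Im z \<noteq> 0"
  shows "(\<lambda>n. F (z + complex_of_real (inverse (real (Suc n))))) \<longlonglongrightarrow> F z"
proof -
  let ?w = "\<lambda>n. z + complex_of_real (inverse (real (Suc n)))"
  have "(\<lambda>n. F z - (z - ?w n) * gram z (?w n)) \<longlonglongrightarrow> F z - (z - z) * gram z z"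
    by (intro tendsto_intros tendsto_real_shift gram_real_shift assms)
  moreover have "F z - (z - ?w n) * gram z (?w n) = F (?w n)" for n
    using cauchy_transform_diff[of z "?w n"] assms by (simp add: algebra_simps)
  ultimately show ?thesis by simp
qed

text \<open>Comparing z with its conjugate gives Im F(z) = Im z times the squared norm of the
  resolvent, and a nowhere vanishing function has norm zero only for the zero measure.\<close>

lemma Im_cauchy_transform:
  assumes z: "Im z \<noteq> 0" and M: "emeasure M (space M) \<noteq> 0"
  shows "Im (F z) \<noteq> 0"
proof
  assume "Im (F z) = 0"
  then have "F z - F (cnj z) = 0"
    by (simp add: cauchy_transform_cnj complex_eq_iff)
  then have "gram z (cnj z) = 0"
    using cauchy_transform_diff[of z "cnj z"] z by (auto simp: complex_eq_iff)
  moreover have "gram z (cnj z) = complex_of_real (\<integral>t. (cmod (resolvent z t))\<^sup>2 \<partial>M)"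
    unfolding gram_def cnj_resolvent[symmetric] complex_norm_square[symmetric]
    by (rule integral_complex_of_real)
  ultimately have "(\<integral>t. (cmod (resolvent z t))\<^sup>2 \<partial>M) = 0"
    by simp
  then have "AE t in M. (cmod (resolvent z t))\<^sup>2 = 0"
    using L2_resolvent[OF z] by (subst (asm) integral_nonneg_eq_0_iff_AE) (auto simp: L2_def)
  moreover have "resolvent z t \<noteq> 0" for t
    using of_real_neq_nonreal[OF z] by (simp add: resolvent_def)
  ultimately have "AE t in M. False" by simp
  with M show False
    by (simp add: AE_iff_null null_sets_def)
qed

end

text \<open>With $H=1+\alpha F$ these are the pairs $(f, Vf)$ for $f$ in the span of the resolvents with
  poles in $A$. Working with the graph of $V$ avoids showing that $Vf$ does not depend on the
  representation of $f$.\<close>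

inductive res_pair :: "(complex \<Rightarrow> complex) \<Rightarrow> complex set \<Rightarrow>
    (real \<Rightarrow> complex) \<Rightarrow> (real \<Rightarrow> complex) \<Rightarrow> bool" for H A where
  zero: "res_pair H A (\<lambda>t. 0) (\<lambda>s. 0)"
| add: "res_pair H A f v \<Longrightarrow> z \<in> A \<Longrightarrow>
    res_pair H A (\<lambda>t. f t + c * resolvent z t) (\<lambda>s. v s + c * H z * resolvent z s)"

lemma res_pair_add:
  assumes "res_pair H A f v" "res_pair H A g w"
  shows "res_pair H A (\<lambda>t. f t + g t) (\<lambda>s. v s + w s)"
  using assms(2)
proof induction
  case zero
  then show ?case using assms(1) by simp
next
  case (add g w z c)
  from res_pair.add[OF add.IH \<open>z \<in> A\<close>, of c] show ?case
    by (simp add: add.assoc)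
qed

lemma res_pair_cmult:
  assumes "res_pair H A f v"
  shows "res_pair H A (\<lambda>t. k * f t) (\<lambda>s. k * v s)"
  using assms
proof induction
  case zero
  then show ?case by (simp add: res_pair.zero)
next
  case (add g w z c)
  from res_pair.add[OF add.IH \<open>z \<in> A\<close>, of "k * c"] show ?case
    by (simp add: algebra_simps)
qed

lemma res_pair_diff:
  assumes "res_pair H A f v" "res_pair H A g w"
  shows "res_pair H A (\<lambda>t. f t - g t) (\<lambda>s. v s - w s)"
  using res_pair_add[OF assms(1) res_pair_cmult[OF assms(2), of "-1"]] by simp

lemma res_pair_mono:
  assumes "res_pair H A f v" "A \<subseteq> B"
  shows "res_pair H B f v"
  using assms by induction (auto intro: res_pair.intros)

section \<open>The averaged commutator kernel\<close>

definition cay :: "real \<Rightarrow> complex \<Rightarrow> complex" where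
  "cay h z = (1 + \<i> * h * z) / (1 - \<i> * h * z)"

text \<open>For $s\ne t$ this is $a\,(c(s)\overline{c(t)}-1)/\bigl((s-t)(1-a\,c(s)\overline{c(t)})\bigr)$
  with $c$ the Cayley transform, written so that the singularity at $s=t$ cancels.\<close>

definition kern :: "real \<Rightarrow> real \<Rightarrow> real \<Rightarrow> real \<Rightarrow> complex" where
  "kern h a s t = 2 * \<i> * h * a /
     ((1 - \<i> * h * s) * (1 + \<i> * h * t) - a * (1 + \<i> * h * s) * (1 - \<i> * h * t))"

text \<open>For nonzero h, the single pole of the rational function (1 - iht)/(1 + iht), which on
  the real line is the conjugate Cayley transform.\<close>

definition pole :: "real \<Rightarrow> complex" where "pole h = \<i> / h"

lemma Im_pole: "h \<noteq> 0 \<Longrightarrow> Im (pole h) \<noteq> 0"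
  by (simp add: pole_def)

lemma one_plus_minus_nz [simp]: "1 + \<i> * complex_of_real h * complex_of_real t \<noteq> 0"
   "1 - \<i> * complex_of_real h * complex_of_real t \<noteq> 0"
   "\<i> * complex_of_real h * complex_of_real t \<noteq> 1"
  by (auto simp: complex_eq_iff)

lemma cnj_cay: "cnj (cay h (complex_of_real t)) =
    (1 - \<i> * h * t) / (1 + \<i> * h * t)"
  by (simp add: cay_def)

lemma norm_one_minus: "cmod (1 - \<i> * complex_of_real h * complex_of_real t) =
    cmod (1 + \<i> * complex_of_real h * complex_of_real t)"
  by (simp add: cmod_def)

lemma norm_cay [simp]: "cmod (cay h (complex_of_real t)) = 1"
  by (simp add: cay_def norm_divide norm_one_minus)

lemma cay_mult_cnj: "cay h (complex_of_real t) * cnj (cay h (complex_of_real t)) = 1"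
  by (simp add: complex_norm_square[symmetric])

lemma one_le_norm: "1 \<le> cmod (1 + \<i> * complex_of_real h * complex_of_real t)"
  using complex_Re_le_cmod[of "1 + \<i> * complex_of_real h * complex_of_real t"] by simp

text \<open>The two products have equal moduli for real s and t, and the factor a < 1 in front of
  one of them keeps their difference away from zero.\<close>

lemma kern_denominator:
  assumes "0 < a" "a < 1"
  shows "(1 - a) * (cmod (1 + \<i> * complex_of_real h * complex_of_real s) * cmod (1 + \<i> * complex_of_real h * complex_of_real t))
    \<le> cmod ((1 - \<i> * h * s) * (1 + \<i> * h * t) - a * (1 + \<i> * h * s) * (1 - \<i> * h * t))"
proof -
  have "(1 - a) * (cmod (1 + \<i> * h * s) * cmod (1 + \<i> * h * t)) =
      cmod ((1 - \<i> * h * s) * (1 + \<i> * h * t)) - cmod (a * (1 + \<i> * h * s) * (1 - \<i> * h * t))"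
    unfolding norm_mult norm_one_minus norm_of_real using assms by (simp add: left_diff_distrib)
  also have "\<dots> \<le> cmod ((1 - \<i> * h * s) * (1 + \<i> * h * t) - a * (1 + \<i> * h * s) * (1 - \<i> * h * t))"
    by (rule norm_triangle_ineq2)
  finally show ?thesis .
qed

lemma kern_denominator_nz:
  assumes "0 < a" "a < 1"
  shows "(1 - \<i> * complex_of_real h * complex_of_real s) * (1 + \<i> * complex_of_real h * complex_of_real t) -
     complex_of_real a * (1 + \<i> * complex_of_real h * complex_of_real s) * (1 - \<i> * complex_of_real h * complex_of_real t) \<noteq> 0"
proof -
  have "0 < (1 - a) * (cmod (1 + \<i> * complex_of_real h * complex_of_real s) * cmod (1 + \<i> * complex_of_real h * complex_of_real t))"
    using assms by simp
  then show ?thesis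
    using kern_denominator[OF assms, of h s t] by (metis linorder_not_less norm_zero)
qed

text \<open>The majorant separates s and t into two square integrable factors, so Cauchy-Schwarz
  bounds the operator for fixed h and a.\<close>

lemma norm_kern_le:
  assumes "0 < a" "a < 1"
  shows "cmod (kern h a s t) \<le> 2 * \<bar>h\<bar> / (1 - a) *
    (cmod (1 / (1 + \<i> * complex_of_real h * complex_of_real s)) * cmod (1 / (1 + \<i> * complex_of_real h * complex_of_real t)))"
proof -
  let ?x = "cmod (1 + \<i> * complex_of_real h * complex_of_real s)"
  let ?y = "cmod (1 + \<i> * complex_of_real h * complex_of_real t)"
  have "cmod (kern h a s t) \<le> cmod (2 * \<i> * h * a) / ((1 - a) * (?x * ?y))"
    unfolding kern_def norm_divide
    using assms kern_denominator_nz[OF assms, of h s t]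
    by (intro divide_left_mono kern_denominator mult_pos_pos) auto
  also have "\<dots> \<le> 2 * \<bar>h\<bar> / ((1 - a) * (?x * ?y))"
    using assms by (intro divide_right_mono) (auto simp: norm_mult mult_left_le)
  also have "\<dots> = 2 * \<bar>h\<bar> / (1 - a) * (cmod (1 / (1 + \<i> * h * s)) * cmod (1 / (1 + \<i> * h * t)))"
    by (simp add: norm_divide)
  finally show ?thesis .
qed

text \<open>For a = 1 - 2h eps with h eps > 0 the constant is 1/|eps|, which is free of h: the
  majorant for the limit h -> 0.\<close>

lemma norm_kern_le_const:
  assumes "0 < a" "a < 1"
  shows "cmod (kern h a s t) \<le> 2 * \<bar>h\<bar> / (1 - a)"
proof -
  have "cmod (1 / (1 + \<i> * complex_of_real h * complex_of_real t)) \<le> 1" for t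
    using one_le_norm[of h t] by (simp add: norm_divide)
  then have "cmod (1 / (1 + \<i> * complex_of_real h * complex_of_real s)) * cmod (1 / (1 + \<i> * complex_of_real h * complex_of_real t)) \<le> 1"
    by (intro mult_le_one) auto
  with norm_kern_le[OF assms, of h s t] show ?thesis
    using assms mult_left_mono[of _ 1 "2 * \<bar>h\<bar> / (1 - a)"] by (auto intro: order_trans)
qed

text \<open>With w = c(s) conj(c(t)) this is 1/(1 - aw) = 1 + aw/(1 - aw), multiplied by a (w -
  1)/(s - t). The first summand comes from the rank one kernel (w - 1)/(s - t) = 2ih/((1 - ihs)(1 +
  iht)).\<close>

lemma kern_eq:
  assumes "0 < a" "a < 1"
  shows "kern h a s t = a * (2 * \<i> * h / (1 - \<i> * h * s) * (1 / (1 + \<i> * h * t))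
     + cay h s * (kern h a s t * cnj (cay h t)))"
proof -
  have *: "d / (x * y - b * z * w) = b * (e / x * (1 / y) + z / x * (d / (x * y - b * z * w) * (w / y)))"
    if "x \<noteq> 0" "y \<noteq> 0" "x * y - b * z * w \<noteq> 0" "d = b * e" for x y z w b d e :: complex
    using that by (simp add: field_simps)
  show ?thesis
    unfolding kern_def cnj_cay unfolding cay_def
    by (rule *[OF one_plus_minus_nz(2,1) kern_denominator_nz[OF assms]]) simp
qed

lemma borel_measurable_kern [measurable]:
  "(\<lambda>(s, t). kern h a s t) \<in> borel_measurable (borel \<Otimes>\<^sub>M borel)"
  unfolding kern_def by measurable

lemma inverse_one_plus: "h \<noteq> 0 \<Longrightarrow> 1 / (1 + \<i> * complex_of_real h * complex_of_real t) = 1 / (\<i> * h) * resolvent (pole h) t"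
  using of_real_neq_nonreal[OF Im_pole, of h t]
  by (simp add: resolvent_def pole_def divide_simps) (simp add: algebra_simps)

text \<open>Partial fractions for -(t + p)/(t - p) times 1/(t - z), with p = i/h. The first
  coefficient is the value of the rational factor at z, the second its residue -2p at p divided by p
  - z. For z = p a double pole would appear.\<close>

lemma cay_resolvent:
  assumes "h \<noteq> 0" "z \<noteq> pole h" "Im z \<noteq> 0"
  shows "cnj (cay h t) * resolvent z t =
    (1 - \<i> * h * z) / (1 + \<i> * h * z) * resolvent z t + (2 * \<i> / h) / (z - pole h) * resolvent (pole h) t"
proof -
  have 1: "1 + \<i> * h * z = \<i> * h * (z - pole h)" for z
    using assms(1) by (simp add: pole_def algebra_simps)
  have 2: "1 - \<i> * h * z = - \<i> * h * (z + pole h)" for z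
    using assms(1) by (simp add: pole_def algebra_simps)
  have *: "- \<i> * h * (t + p) / (\<i> * h * (t - p)) * (1 / (t - z)) =
    - \<i> * h * (z + p) / (\<i> * h * (z - p)) * (1 / (t - z)) + 2 * p / (z - p) * (1 / (t - p))"
    if nz: "t - p \<noteq> 0" "t - z \<noteq> 0" "z - p \<noteq> 0" for t p z :: complex
  proof -
    have cancel: "- \<i> * h * x / (\<i> * h * y) = - x / y" for x y :: complex
      using assms(1) by simp
    have "- (t + p) / (t - p) * (1 / (t - z)) =
        (- (z + p) * (t - p) + 2 * p * (t - z)) / ((z - p) * (t - p) * (t - z))"
    proof -
      have "- (z + p) * (t - p) + 2 * p * (t - z) = (z - p) * - (t + p)"
        by (simp add: algebra_simps)
      then show ?thesis using nz by simp
    qed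
    also have "\<dots> = - (z + p) / (z - p) * (1 / (t - z)) + 2 * p / (z - p) * (1 / (t - p))"
      unfolding add_divide_distrib using nz by simp
    finally show ?thesis unfolding cancel .
  qed
  show ?thesis
    unfolding cnj_cay 1 2 resolvent_def
    using *[of t "pole h" z] of_real_neq_nonreal[OF assms(3), of t]
      of_real_neq_nonreal[OF Im_pole[OF assms(1)], of t] assms(2)
    by (simp add: pole_def)
qed

text \<open>The choice a = 1 - 2h eps splits off a factor 2h, which cancels against the numerator of
  \<open>kern\<close> and leaves a nonzero limit.\<close>

lemma kern_limit_denominator:
  fixes h \<epsilon> s t :: real
  shows "(1 - \<i> * h * s) * (1 + \<i> * h * t) - complex_of_real (1 - 2 * h * \<epsilon>) * (1 + \<i> * h * s) * (1 - \<i> * h * t)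
    = 2 * h * (\<epsilon> * (1 + h\<^sup>2 * s * t) - (1 - h * \<epsilon>) * \<i> * (s - t))"
  by (simp add: algebra_simps power2_eq_square)

lemma kern_tendsto:
  assumes "\<epsilon> \<noteq> 0" "h \<longlonglongrightarrow> 0" "\<And>n. h n \<noteq> 0"
  shows "(\<lambda>n. kern (h n) (1 - 2 * h n * \<epsilon>) s t) \<longlonglongrightarrow> - (1 / (complex_of_real s - complex_of_real t + \<i> * \<epsilon>))"
proof -
  have nz: "complex_of_real \<epsilon> - \<i> * (s - t) \<noteq> 0" "complex_of_real s - t + \<i> * \<epsilon> \<noteq> 0"
    using assms(1) by (auto simp: complex_eq_iff)
  have eq: "kern (h n) (1 - 2 * h n * \<epsilon>) s t =
      \<i> * complex_of_real (1 - 2 * h n * \<epsilon>) / (\<epsilon> * (1 + (h n)\<^sup>2 * s * t) - (1 - h n * \<epsilon>) * \<i> * (s - t))" for n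
    unfolding kern_def kern_limit_denominator using assms(3)[of n] by simp
  have "(\<lambda>n. \<i> * complex_of_real (1 - 2 * h n * \<epsilon>) / (\<epsilon> * (1 + (h n)\<^sup>2 * s * t) - (1 - h n * \<epsilon>) * \<i> * (s - t)))
      \<longlonglongrightarrow> \<i> * complex_of_real (1 - 2 * 0 * \<epsilon>) / (\<epsilon> * (1 + 0\<^sup>2 * s * t) - (1 - 0 * \<epsilon>) * \<i> * (s - t))"
    by (intro tendsto_intros assms(2)) (use nz in simp)
  moreover have "\<i> * complex_of_real (1 - 2 * 0 * \<epsilon>) / (\<epsilon> * (1 + 0\<^sup>2 * s * t) - (1 - 0 * \<epsilon>) * \<i> * (s - t))
      = - (1 / (complex_of_real s - complex_of_real t + \<i> * \<epsilon>))"
  proof -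
    have "complex_of_real s - t + \<i> * \<epsilon> = \<i> * (\<epsilon> - \<i> * (s - t))"
      by (simp add: algebra_simps)
    moreover have "\<i> / x = - (1 / (\<i> * x))" for x
      by (simp add: divide_inverse)
    ultimately show ?thesis by simp
  qed
  ultimately show ?thesis unfolding eq by simp
qed

text \<open>Each value of \<open>T_op\<close> tests \<open>f\<close> against a single resolvent, so
  approximate orthogonality to resolvents gives pointwise convergence in
  \<open>T_op_bound\<close>.\<close>

lemma T_op_inner: "T_op M \<epsilon> f s = - L2_inner M f (resolvent (s - \<i> * \<epsilon>))"
proof -
  have "f t / (complex_of_real s - t + \<i> * \<epsilon>) = - (f t * resolvent (s + \<i> * \<epsilon>) t)" for t
  proof -
    have "complex_of_real s - t + \<i> * \<epsilon> = - (t - (s + \<i> * \<epsilon>))" by simp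
    then show ?thesis
      unfolding resolvent_def by (metis divide_minus_right mult.right_neutral times_divide_eq_right)
  qed
  then show ?thesis
    unfolding T_op_def L2_inner_def cnj_resolvent by simp
qed

section \<open>The intertwining isometry\<close>

abbreviation nonreal :: "complex set" where "nonreal \<equiv> {z. Im z \<noteq> 0}"

locale perturbed_pair = M: cauchy_measure M + N: cauchy_measure N
  for M N :: "real measure" +
  fixes \<alpha> :: real
  assumes \<alpha>_nz: "\<alpha> \<noteq> 0"
    and M_nz: "emeasure M (space M) \<noteq> 0"
    and pert: "Im z \<noteq> 0 \<Longrightarrow> N.F z = M.F z / (1 + complex_of_real \<alpha> * M.F z)"
begin

definition H :: "complex \<Rightarrow> complex" where "H z = 1 + complex_of_real \<alpha> * M.F z"

lemma H_nz: "Im z \<noteq> 0 \<Longrightarrow> H z \<noteq> 0"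
  using M.Im_cauchy_transform[of z] M_nz \<alpha>_nz by (auto simp: H_def complex_eq_iff)

lemma H_cnj: "H (cnj z) = cnj (H z)"
  by (simp add: H_def M.cauchy_transform_cnj)

lemma H_diff: "Im z \<noteq> 0 \<Longrightarrow> Im w \<noteq> 0 \<Longrightarrow> H z - H w = complex_of_real \<alpha> * (z - w) * M.gram z w"
  using M.cauchy_transform_diff[of z w] by (simp add: H_def mult.assoc flip: right_diff_distrib)

text \<open>In F(z) H(w) - F(w) H(z) the terms with \<alpha> cancel, so the Cauchy transform of
  \<open>N\<close> has the difference (F(z) - F(w))/(H(z) H(w)). Division by z - w compares the Gram
  entries off the diagonal, and continuity along a real shift covers z = w.\<close>

lemma gram_perturbed:
  assumes z: "Im z \<noteq> 0" and w: "Im w \<noteq> 0"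
  shows "H z * H w * N.gram z w = M.gram z w"
proof -
  have *: "H z * H w * N.gram z w = M.gram z w" if "z \<noteq> w" "Im w \<noteq> 0" for w
  proof -
    have "N.F z - N.F w = (M.F z - M.F w) / (H z * H w)"
      using H_nz[OF z] H_nz[OF that(2)] pert[OF z] pert[OF that(2)]
      by (simp add: diff_frac_eq flip: H_def) (simp add: H_def algebra_simps)
    then have "(z - w) * (H z * H w * N.gram z w) = (z - w) * M.gram z w"
      using N.cauchy_transform_diff[OF z that(2)] M.cauchy_transform_diff[OF z that(2)]
        H_nz[OF z] H_nz[OF that(2)] by (simp add: field_simps)
    then show ?thesis using that by simp
  qed
  show ?thesis
  proof (cases "z = w")
    case False
    then show ?thesis using * w by simp
  next
    case True
    let ?w = "\<lambda>n. z + complex_of_real (inverse (real (Suc n)))"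
    have "(\<lambda>n. H z * H (?w n) * N.gram z (?w n)) \<longlonglongrightarrow> H z * H z * N.gram z z"
      unfolding H_def
      by (intro tendsto_intros M.cauchy_transform_real_shift N.gram_real_shift z)
    moreover have "H z * H (?w n) * N.gram z (?w n) = M.gram z (?w n)" for n
      by (rule *) (use z in \<open>auto simp del: of_nat_Suc\<close>)
    ultimately have "(\<lambda>n. M.gram z (?w n)) \<longlonglongrightarrow> H z * H z * N.gram z z"
      by simp
    then show ?thesis
      using M.gram_real_shift[OF z z] LIMSEQ_unique True by blast
  qed
qed

abbreviation pair :: "complex set \<Rightarrow> (real \<Rightarrow> complex) \<Rightarrow> (real \<Rightarrow> complex) \<Rightarrow> bool" where
  "pair \<equiv> res_pair H"

lemma pair_L2:
  assumes "pair nonreal f v"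
  shows "L2 M f \<and> L2 N v \<and> integrable M f"
  using assms
  by induction (auto intro!: L2_zero L2_add L2_cmult M.L2_resolvent N.L2_resolvent M.integrable_resolvent
      Bochner_Integration.integrable_add)

text \<open>The norm of a sum involves cross terms, so equality is proved for inner products of two
  independent pairs, by induction on each in turn, and then specialised.\<close>

lemma pair_isometry:
  assumes "pair nonreal f v"
  shows "L2_norm N v = L2_norm M f"
proof -
  have single: "L2_inner N (\<lambda>s. c * H z * resolvent z s) (\<lambda>s. d * H w * resolvent w s)
      = L2_inner M (\<lambda>t. c * resolvent z t) (\<lambda>t. d * resolvent w t)"
    if "Im z \<noteq> 0" "Im w \<noteq> 0" for c d z w
    unfolding L2_inner_cmult_left L2_inner_cmult_right
    using gram_perturbed[of z "cnj w"] that
    by (simp add: L2_inner_def cnj_resolvent H_cnj M.gram_def N.gram_def mult.assoc)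
  have half: "L2_inner N v (\<lambda>s. d * H w * resolvent w s) = L2_inner M f (\<lambda>t. d * resolvent w t)"
    if "pair nonreal f v" "Im w \<noteq> 0" for f v d w
    using that(1)
  proof induction
    case zero
    then show ?case by (simp add: L2_inner_def)
  next
    case (add f v z c)
    then show ?case
      using pair_L2[OF add.hyps(1)] single[of z w c d] that(2)
      by (subst (1 2) L2_inner_add_left) (auto intro: L2_cmult M.L2_resolvent N.L2_resolvent)
  qed
  have "L2_inner N v w = L2_inner M f g" if "pair nonreal g w" for g w
    using that
  proof induction
    case zero
    then show ?case by (simp add: L2_inner_def)
  next
    case (add g w z c)
    then show ?case
      using pair_L2[OF add.hyps(1)] pair_L2[OF assms] half[OF assms, of z c]
      by (subst (1 2) L2_inner_add_right) (auto intro: L2_cmult M.L2_resolvent N.L2_resolvent)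
  qed
  from this[OF assms] have "(L2_norm N v)\<^sup>2 = (L2_norm M f)\<^sup>2"
    by (simp add: L2_inner_self del: of_real_power)
  then show ?thesis by simp
qed

section \<open>The averaged operator, its functional equation and the commutator relation\<close>

definition K :: "real \<Rightarrow> real \<Rightarrow> (real \<Rightarrow> complex) \<Rightarrow> real \<Rightarrow> complex" where
  "K h a f s = (\<integral>t. kern h a s t * f t \<partial>M)"

text \<open>The kernel is (c(s) conj(c(t)) - 1)/(s - t), so \<alpha>X is the rank one commutator c V
  conj(c) - V.\<close>

definition X :: "real \<Rightarrow> (real \<Rightarrow> complex) \<Rightarrow> real \<Rightarrow> complex" where
  "X h f s = 2 * \<i> * h / (1 - \<i> * h * s) * (\<integral>t. 1 / (1 + \<i> * h * t) * f t \<partial>M)"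

lemma L2_inverse_one_plus:
  fixes h :: real
  assumes "h \<noteq> 0"
  shows "L2 M (\<lambda>t. 1 / (1 + \<i> * h * t))" "L2 N (\<lambda>t. 1 / (1 + \<i> * h * t))"
  unfolding inverse_one_plus[OF assms]
  by (intro L2_cmult M.L2_resolvent N.L2_resolvent Im_pole assms)+

lemma integrable_kern_mult:
  assumes "integrable M f" "0 < a" "a < 1"
  shows "integrable M (\<lambda>t. kern h a s t * f t)"
proof (rule Bochner_Integration.integrable_bound)
  show "integrable M (\<lambda>t. (2 * \<bar>h\<bar> / (1 - a)) *\<^sub>R f t)"
    using assms by simp
  show "AE t in M. cmod (kern h a s t * f t) \<le> cmod ((2 * \<bar>h\<bar> / (1 - a)) *\<^sub>R f t)"
    using assms mult_right_mono[OF norm_kern_le_const[OF assms(2,3)] norm_ge_zero]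
    by (intro AE_I2) (simp add: norm_mult)
qed (use assms in measurable)

lemma K_L2:
  assumes f: "L2 M f" and h: "h \<noteq> 0" and a: "0 < a" "a < 1"
  defines "C \<equiv> 2 * \<bar>h\<bar> / (1 - a) * (L2_norm M (\<lambda>t. 1 / (1 + \<i> * h * t)) * L2_norm N (\<lambda>t. 1 / (1 + \<i> * h * t)))"
  shows "L2 N (K h a f)" "L2_norm N (K h a f) \<le> C * L2_norm M f"
proof -
  let ?u = "\<lambda>t. 1 / (1 + \<i> * complex_of_real h * complex_of_real t)"
  let ?c = "2 * \<bar>h\<bar> / (1 - a) * (L2_norm M ?u * L2_norm M f)"
  have c: "?c \<ge> 0" using a by simp
  have [measurable]: "f \<in> borel_measurable M" using f by (simp add: L2_def)
  have 1: "K h a f \<in> borel_measurable N"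
    unfolding K_def by measurable
  have 2: "cmod (K h a f s) \<le> cmod (complex_of_real ?c * ?u s)" for s
  proof -
    have int: "integrable M (\<lambda>t. cmod (?u t * f t))"
      by (intro integrable_norm L2_integrable_mult L2_inverse_one_plus f h)
    have le: "cmod (kern h a s t * f t) \<le> 2 * \<bar>h\<bar> / (1 - a) * cmod (?u s) * cmod (?u t * f t)" for t
      using mult_right_mono[OF norm_kern_le[OF a, of h s t] norm_ge_zero, of "f t"]
      by (simp only: norm_mult mult.assoc)
    have int': "integrable M (\<lambda>t. 2 * \<bar>h\<bar> / (1 - a) * cmod (?u s) * cmod (?u t * f t))"
      using int by (rule integrable_mult_right)
    have "integrable M (\<lambda>t. kern h a s t * f t)"
      by (rule Bochner_Integration.integrable_bound[OF int'])
        (auto intro!: AE_I2 order_trans[OF le abs_ge_self] simp del: times_divide_eq_left times_divide_eq_right)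
    then have "cmod (K h a f s) \<le> (\<integral>t. 2 * \<bar>h\<bar> / (1 - a) * cmod (?u s) * cmod (?u t * f t) \<partial>M)"
      unfolding K_def using int' by (rule Bochner_Integration.integral_norm_bound_integral) (rule le)
    also have "\<dots> = 2 * \<bar>h\<bar> / (1 - a) * cmod (?u s) * (\<integral>t. cmod (?u t * f t) \<partial>M)"
      by (rule integral_mult_right_zero)
    also have "\<dots> \<le> 2 * \<bar>h\<bar> / (1 - a) * cmod (?u s) * (L2_norm M ?u * L2_norm M f)"
      using a by (intro mult_left_mono L2_integral_norm_mult_le L2_inverse_one_plus f h) auto
    also have "\<dots> = cmod (complex_of_real ?c * ?u s)"
      using c by (simp only: norm_mult norm_of_real abs_of_nonneg) (simp only: mult_ac)
    finally show ?thesis .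
  qed
  note L = L2_norm_mono[OF L2_cmult[OF L2_inverse_one_plus(2)[OF h]] 1 2]
  show "L2 N (K h a f)" by (rule L(1))
  from L(2) show "L2_norm N (K h a f) \<le> C * L2_norm M f"
    unfolding L2_norm_cmult norm_of_real abs_of_nonneg[OF c] C_def by (simp only: mult_ac)
qed

lemma K_eq:
  assumes f: "integrable M f" and a: "0 < a" "a < 1"
  shows "K h a f s = a * (X h f s + cay h s * K h a (\<lambda>t. cnj (cay h t) * f t) s)"
proof -
  have bd: "cmod (1 / (1 + \<i> * complex_of_real h * complex_of_real t)) \<le> 1" for t
    using one_le_norm[of h t] by (simp add: norm_divide)
  have [measurable]: "f \<in> borel_measurable M" using f by simp
  have 1: "integrable M (\<lambda>t. 1 / (1 + \<i> * h * t) * f t)"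
    by (rule Bochner_Integration.integrable_bound[OF f])
      (auto simp: norm_mult intro!: mult_left_le_one_le bd AE_I2 simp del: times_divide_eq_left)
  have "(\<lambda>t. cnj (cay h t) * f t) \<in> borel_measurable M"
    unfolding cnj_cay by measurable
  then have "integrable M (\<lambda>t. cnj (cay h t) * f t)"
    by (rule Bochner_Integration.integrable_bound[OF f]) (simp add: norm_mult)
  then have 2: "integrable M (\<lambda>t. kern h a s t * (cnj (cay h t) * f t))"
    by (intro integrable_kern_mult a)
  have "K h a f s = (\<integral>t. a * (2 * \<i> * h / (1 - \<i> * h * s) * (1 / (1 + \<i> * h * t) * f t)
     + cay h s * (kern h a s t * (cnj (cay h t) * f t))) \<partial>M)"
    unfolding K_def by (subst kern_eq[OF a], simp only: distrib_right distrib_left mult.assoc)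
  also have "\<dots> = a * (X h f s + cay h s * K h a (\<lambda>t. cnj (cay h t) * f t) s)"
    unfolding X_def K_def
    by (simp only: integral_mult_right_zero Bochner_Integration.integral_add integrable_mult_right 1 2)
  finally show ?thesis .
qed

text \<open>This is the commutator relation c V conj(c) = V + \<alpha>X on the graph of V.
  Multiplication by conj(c) turns the pole z into the poles z and p = i/h. Applying V afterwards
  weights the new pole by H(p), applying it before by H(z), and \<open>H_diff\<close> identifies the
  discrepancy with the rank one term.\<close>

lemma pair_cay:
  assumes "h \<noteq> 0" "pair (nonreal - {pole h}) f v"
  shows "pair nonreal (\<lambda>t. cnj (cay h t) * f t) (\<lambda>s. cnj (cay h s) * (v s + \<alpha> * X h f s))"
  using assms(2)
proof induction
  case zero
  then show ?case by (simp add: X_def res_pair.zero)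
next
  case (add f v z k)
  let ?p = "pole h"
  have z: "Im z \<noteq> 0" "z \<noteq> ?p" using add.hyps by auto
  define b d where "b = (1 - \<i> * h * z) / (1 + \<i> * h * z)" and "d = (2 * \<i> / h) / (z - ?p)"
  have c: "cnj (cay h t) * resolvent z t = b * resolvent z t + d * resolvent ?p t" for t
    unfolding b_def d_def by (rule cay_resolvent) (use assms z in auto)
  have int: "integrable M (\<lambda>t. 1 / (1 + \<i> * h * t) * f t)"
    using pair_L2[OF res_pair_mono[OF add.hyps(1)]] by (intro L2_integrable_mult L2_inverse_one_plus assms) auto
  have int': "integrable M (\<lambda>t. 1 / (1 + \<i> * h * t) * (k * resolvent z t))"
    using M.L2_resolvent z by (intro L2_integrable_mult L2_inverse_one_plus assms L2_cmult)
  have Xadd: "X h (\<lambda>t. f t + k * resolvent z t) s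
      = X h f s + k * (2 / (1 - \<i> * h * s) * M.gram z ?p)" for s
  proof -
    have "(\<integral>t. 1 / (1 + \<i> * h * t) * (k * resolvent z t) \<partial>M) = k / (\<i> * h) * M.gram z ?p"
      unfolding inverse_one_plus[OF assms(1)] M.gram_def integral_mult_right_zero[symmetric]
      by (intro Bochner_Integration.integral_cong) auto
    moreover have "2 * \<i> * h / (1 - \<i> * h * s) * (k / (\<i> * h) * M.gram z ?p)
        = k * (2 / (1 - \<i> * h * s) * M.gram z ?p)"
      using assms(1) by simp
    ultimately show ?thesis
      unfolding X_def by (simp only: distrib_left Bochner_Integration.integral_add[OF int int'])
  qed
  have Hd: "\<alpha> * M.gram z ?p = (H z - H ?p) / (z - ?p)"
    using H_diff[of z ?p] z Im_pole[OF assms(1)] by simp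
  have cX: "cnj (cay h s) * (\<alpha> * (2 / (1 - \<i> * h * s) * M.gram z ?p)) = d * (H ?p - H z) * resolvent ?p s" for s
  proof -
    have "cnj (cay h s) * (\<alpha> * (2 / (1 - \<i> * h * s) * M.gram z ?p)) =
      2 * (1 / (1 + \<i> * h * s)) * (\<alpha> * M.gram z ?p)"
      by (simp add: cnj_cay)
    also have "\<dots> = d * (H ?p - H z) * resolvent ?p s"
      unfolding inverse_one_plus[OF assms(1)] Hd d_def using z assms(1) by (simp add: field_simps)
    finally show ?thesis .
  qed
  have "pair nonreal (\<lambda>t. (cnj (cay h t) * f t + (k * b) * resolvent z t) + (k * d) * resolvent ?p t)
    (\<lambda>s. (cnj (cay h s) * (v s + \<alpha> * X h f s) + (k * b) * H z * resolvent z s) + (k * d) * H ?p * resolvent ?p s)"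
    by (intro res_pair.add add.IH) (use z Im_pole[OF assms(1)] in auto)
  moreover have "(cnj (cay h t) * f t + (k * b) * resolvent z t) + (k * d) * resolvent ?p t =
      cnj (cay h t) * (f t + k * resolvent z t)" for t
    unfolding distrib_left mult.left_commute[of _ k] c by (simp add: algebra_simps)
  moreover have "(cnj (cay h s) * (v s + \<alpha> * X h f s) + (k * b) * H z * resolvent z s) + (k * d) * H ?p * resolvent ?p s
    = cnj (cay h s) * (v s + k * H z * resolvent z s + \<alpha> * X h (\<lambda>t. f t + k * resolvent z t) s)" for s
  proof -
    have "cnj (cay h s) * (v s + k * H z * resolvent z s + \<alpha> * X h (\<lambda>t. f t + k * resolvent z t) s)
      = cnj (cay h s) * (v s + \<alpha> * X h f s) + k * H z * (cnj (cay h s) * resolvent z s)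
        + k * (cnj (cay h s) * (\<alpha> * (2 / (1 - \<i> * h * s) * M.gram z ?p)))"
      unfolding Xadd by (simp only: distrib_left distrib_right mult_ac add_ac)
    also have "\<dots> = cnj (cay h s) * (v s + \<alpha> * X h f s) + k * H z * (b * resolvent z s + d * resolvent ?p s)
        + k * (d * (H ?p - H z) * resolvent ?p s)"
      unfolding c cX ..
    finally show ?thesis by (simp add: algebra_simps)
  qed
  ultimately show ?case by simp
qed

text \<open>Multiplication by the conjugate Cayley transform leaves the span of simple resolvents when the
  function already has the pole $i/h$, so that pole has to be moved slightly.\<close>

lemma pair_avoid:
  assumes "pair nonreal f v" "0 < e" "Im p \<noteq> 0"
  shows "\<exists>g w. pair (nonreal - {p}) g w \<and> L2_norm M (\<lambda>t. f t - g t) < e"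
  using assms(1,2)
proof (induction arbitrary: e)
  case zero
  then show ?case
    by (intro exI[of _ "\<lambda>t. 0"] conjI res_pair.zero) simp
next
  case (add f v z c)
  then obtain g w where g: "pair (nonreal - {p}) g w" "L2_norm M (\<lambda>t. f t - g t) < e / 2"
    using half_gt_zero by blast
  obtain q where q: "Im q \<noteq> 0" "q \<noteq> p"
    "L2_norm M (\<lambda>t. c * resolvent z t - c * resolvent q t) < e / 2"
  proof (cases "z = p")
    case False
    then show thesis using that[of z] add.hyps add.prems by simp
  next
    case True
    define B where "B = cmod c * (1 / \<bar>Im p\<bar>) * L2_norm M (resolvent p)"
    have B: "B \<ge> 0" by (simp add: B_def)
    \<comment> \<open>By the resolvent identity the shift costs at most \<delta> times
      \<open>B\<close>, which has to stay below e/2; \<open>B + 1\<close> is positive even for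
      \<open>B\<close> = 0.\<close>
    define \<delta> where "\<delta> = e / (2 * (B + 1))"
    have \<delta>: "\<delta> > 0" using add.prems B by (simp add: \<delta>_def)
    let ?q = "p + complex_of_real \<delta>"
    have iq: "Im ?q \<noteq> 0" using assms(3) by simp
    have "cmod (c * resolvent z t - c * resolvent ?q t) \<le> cmod (complex_of_real (\<delta> * cmod c * (1 / \<bar>Im p\<bar>)) * resolvent p t)" for t
    proof -
      have "cmod (c * resolvent z t - c * resolvent ?q t) = \<delta> * cmod c * (cmod (resolvent ?q t) * cmod (resolvent p t))"
        using resolvent_identity[OF assms(3) iq, of t] \<delta> True
        by (simp add: norm_mult flip: right_diff_distrib)
      also have "\<dots> \<le> \<delta> * cmod c * (1 / \<bar>Im ?q\<bar> * cmod (resolvent p t))"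
        using norm_resolvent_le[OF iq, of t] \<delta> by (intro mult_left_mono mult_right_mono) auto
      also have "\<dots> = cmod (complex_of_real (\<delta> * cmod c * (1 / \<bar>Im p\<bar>)) * resolvent p t)"
        using \<delta> by (simp add: norm_mult norm_divide)
      finally show ?thesis .
    qed
    then have "L2_norm M (\<lambda>t. c * resolvent z t - c * resolvent ?q t)
        \<le> L2_norm M (\<lambda>t. complex_of_real (\<delta> * cmod c * (1 / \<bar>Im p\<bar>)) * resolvent p t)"
      by (intro L2_norm_mono(2)[OF L2_cmult[OF M.L2_resolvent[OF assms(3)]]]) measurable
    also have "\<dots> = \<delta> * B"
      unfolding L2_norm_cmult B_def using \<delta> by (simp add: norm_mult norm_divide)
    also have "\<dots> < e / 2"
      using add.prems B by (simp add: \<delta>_def field_simps)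
    finally show thesis
      using that[of ?q] iq \<delta> by simp
  qed
  note L = pair_L2[OF add.hyps(1)] pair_L2[OF res_pair_mono[OF g(1)]]
  have "L2_norm M (\<lambda>t. (f t - g t) + (c * resolvent z t - c * resolvent q t)) \<le>
    L2_norm M (\<lambda>t. f t - g t) + L2_norm M (\<lambda>t. c * resolvent z t - c * resolvent q t)"
    using L q add.hyps(2) by (intro L2_norm_triangle L2_diff L2_cmult M.L2_resolvent) auto
  also have "\<dots> < e" using g q by simp
  finally have "L2_norm M (\<lambda>t. (f t + c * resolvent z t) - (g t + c * resolvent q t)) < e"
    by (simp add: algebra_simps)
  moreover have "pair (nonreal - {p}) (\<lambda>t. g t + c * resolvent q t) (\<lambda>s. w s + c * H q * resolvent q s)"
    by (rule res_pair.add[OF g(1)]) (use q in simp)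
  ultimately show ?case by blast
qed

section \<open>Uniform bounds\<close>

lemma S_L2:
  assumes "pair nonreal f v" "h \<noteq> 0" "0 < a" "a < 1"
  shows "L2 N (\<lambda>s. v s + \<alpha> * K h a f s)"
  using pair_L2[OF assms(1)] K_L2(1)[of f h a] assms by (intro L2_add L2_cmult) auto

lemma K_diff:
  assumes "integrable M f" "integrable M g" "0 < a" "a < 1"
  shows "K h a (\<lambda>t. f t - g t) s = K h a f s - K h a g s"
  unfolding K_def right_diff_distrib
  by (intro Bochner_Integration.integral_diff integrable_kern_mult assms)

text \<open>With S = V + \<alpha>K, \<open>K_eq\<close> and \<open>pair_cay\<close> give S g = (1 -
  a) V g + a c S(conj(c) g). Both multiplications preserve the norm, so the summands contribute 1 -
  a and a C.\<close>

lemma contraction_avoid: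
  assumes h: "h \<noteq> 0" and a: "0 < a" "a < 1"
    and C: "\<And>f v. pair nonreal f v \<Longrightarrow> L2_norm N (\<lambda>s. v s + \<alpha> * K h a f s) \<le> C * L2_norm M f"
    and g: "pair (nonreal - {pole h}) g w"
  shows "L2_norm N (\<lambda>s. w s + \<alpha> * K h a g s) \<le> (a * C + (1 - a)) * L2_norm M g"
proof -
  define g' where "g' = (\<lambda>t. cnj (cay h (complex_of_real t)) * g t)"
  define w' where "w' = (\<lambda>s. cnj (cay h (complex_of_real s)) * (w s + \<alpha> * X h g s))"
  define q where "q = (\<lambda>s. w' s + \<alpha> * K h a g' s)"
  have g0: "pair nonreal g w" using g by (rule res_pair_mono) auto
  note L = pair_L2[OF g0]
  have g': "pair nonreal g' w'"
    unfolding g'_def w'_def by (rule pair_cay[OF h g])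
  have q: "L2 N q" unfolding q_def by (rule S_L2[OF g' h a])
  have "(\<lambda>s. cay h (complex_of_real s)) \<in> borel_measurable N"
    unfolding cay_def by measurable
  then have "(\<lambda>s. cay h (complex_of_real s) * q s) \<in> borel_measurable N"
    using q by (auto simp: L2_def)
  then have cq: "L2 N (\<lambda>s. cay h (complex_of_real s) * q s)"
    by (rule L2_norm_mono(1)[OF q]) (simp add: norm_mult)
  have eq: "w s + \<alpha> * K h a g s = complex_of_real (1 - a) * w s + complex_of_real a * (cay h s * q s)" for s
  proof -
    have "cay h s * w' s = w s + \<alpha> * X h g s"
      unfolding w'_def mult.assoc[symmetric] cay_mult_cnj by simp
    moreover have "K h a g s = a * (X h g s + cay h s * K h a g' s)"
      unfolding g'_def using L a by (intro K_eq) auto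
    ultimately show ?thesis
      by (simp add: q_def algebra_simps)
  qed
  have "L2_norm N (\<lambda>s. w s + \<alpha> * K h a g s) \<le>
      L2_norm N (\<lambda>s. complex_of_real (1 - a) * w s) + L2_norm N (\<lambda>s. complex_of_real a * (cay h s * q s))"
    unfolding eq using L by (intro L2_norm_triangle L2_cmult cq) auto
  also have "\<dots> = (1 - a) * L2_norm N w + a * L2_norm N (\<lambda>s. cay h s * q s)"
    unfolding L2_norm_cmult norm_of_real using a by simp
  also have "L2_norm N (\<lambda>s. cay h s * q s) = L2_norm N q"
    by (rule L2_norm_cong) (simp add: norm_mult)
  also have "L2_norm N w = L2_norm M g"
    by (rule pair_isometry[OF g0])
  also have "L2_norm N q \<le> C * L2_norm M g'"
    unfolding q_def by (rule C[OF g'])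
  also have "L2_norm M g' = L2_norm M g"
    unfolding g'_def by (rule L2_norm_cong) (simp add: norm_mult)
  finally show ?thesis
    using a by (simp add: algebra_simps)
qed

text \<open>The given bound \<open>C\<close> already makes S continuous on the span, which controls
  the error of replacing \<open>f\<close> by a nearby function without the pole i/h.\<close>

lemma contraction_step:
  assumes h: "h \<noteq> 0" and a: "0 < a" "a < 1" and "0 \<le> C"
    and C: "\<And>f v. pair nonreal f v \<Longrightarrow> L2_norm N (\<lambda>s. v s + \<alpha> * K h a f s) \<le> C * L2_norm M f"
    and f: "pair nonreal f v"
  shows "L2_norm N (\<lambda>s. v s + \<alpha> * K h a f s) \<le> (a * C + (1 - a)) * L2_norm M f"
proof (rule field_le_epsilon)
  fix e :: real assume "0 < e"
  define B where "B = a * C + (1 - a)"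
  have B: "0 \<le> B" using a \<open>0 \<le> C\<close> by (simp add: B_def)
  \<comment> \<open>The replacement costs B r from the norm of \<open>g\<close> and C r from the
    difference, where r is the distance; the 1 keeps the divisor positive.\<close>
  have "0 < e / (B + C + 1)" using \<open>0 < e\<close> B \<open>0 \<le> C\<close> by simp
  then obtain g w where g: "pair (nonreal - {pole h}) g w"
    and le: "L2_norm M (\<lambda>t. f t - g t) < e / (B + C + 1)"
    using pair_avoid[OF f _ Im_pole[OF h]] by blast
  define r where "r = L2_norm M (\<lambda>t. f t - g t)"
  have g0: "pair nonreal g w" using g by (rule res_pair_mono) auto
  have d: "pair nonreal (\<lambda>t. f t - g t) (\<lambda>s. v s - w s)" by (rule res_pair_diff[OF f g0])
  note L = pair_L2[OF f] pair_L2[OF g0] pair_L2[OF d]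
  have eq: "v s + \<alpha> * K h a f s = (w s + \<alpha> * K h a g s) + ((v s - w s) + \<alpha> * K h a (\<lambda>t. f t - g t) s)" for s
    using L by (subst K_diff) (auto simp: algebra_simps a)
  have "L2_norm N (\<lambda>s. v s + \<alpha> * K h a f s) \<le>
      L2_norm N (\<lambda>s. w s + \<alpha> * K h a g s) + L2_norm N (\<lambda>s. (v s - w s) + \<alpha> * K h a (\<lambda>t. f t - g t) s)"
    unfolding eq by (rule L2_norm_triangle[OF S_L2[OF g0 h a] S_L2[OF d h a]])
  also have "\<dots> \<le> B * L2_norm M g + C * r"
    unfolding B_def r_def by (intro add_mono contraction_avoid C d h a g)
  also have "L2_norm M g \<le> L2_norm M f + r"
  proof -
    have "L2_norm M (\<lambda>t. f t + (-1) * (f t - g t)) \<le> L2_norm M f + L2_norm M (\<lambda>t. (-1) * (f t - g t))"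
      using L by (intro L2_norm_triangle L2_cmult) auto
    then show ?thesis
      unfolding L2_norm_cmult r_def by simp
  qed
  also have "B * (L2_norm M f + r) + C * r = B * L2_norm M f + (B + C) * r"
    by (simp add: algebra_simps)
  also have "(B + C) * r \<le> (B + C + 1) * r"
    by (rule mult_right_mono) (simp_all add: r_def)
  also have "(B + C + 1) * r \<le> e"
    using le B \<open>0 \<le> C\<close> by (simp add: r_def pos_less_divide_eq mult.commute less_imp_le)
  finally show "L2_norm N (\<lambda>s. v s + \<alpha> * K h a f s) \<le> (a * C + (1 - a)) * L2_norm M f + e"
    using B by (simp add: B_def mult_left_mono)
qed

text \<open>The map sending C to a C + (1 - a) has the attracting fixed point 1. Started at the
  crude bound 1 + |\<alpha>| E it leaves the excess a^n |\<alpha>| E after n steps.\<close>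

lemma contraction:
  assumes h: "h \<noteq> 0" and a: "0 < a" "a < 1" and f: "pair nonreal f v"
  shows "L2_norm N (\<lambda>s. v s + \<alpha> * K h a f s) \<le> L2_norm M f"
proof -
  define E where "E = 2 * \<bar>h\<bar> / (1 - a) *
    (L2_norm M (\<lambda>t. 1 / (1 + \<i> * h * t)) * L2_norm N (\<lambda>t. 1 / (1 + \<i> * h * t)))"
  have E: "0 \<le> E"
    unfolding E_def using a by (intro mult_nonneg_nonneg divide_nonneg_nonneg) auto
  have KE: "L2_norm N (K h a f) \<le> E * L2_norm M f" if "L2 M f" for f
    unfolding E_def by (rule K_L2(2)[OF that h a])
  have bound: "L2_norm N (\<lambda>s. v s + \<alpha> * K h a f s) \<le> (1 + a ^ n * (\<bar>\<alpha>\<bar> * E)) * L2_norm M f"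
    if "pair nonreal f v" for n f v
    using that
  proof (induction n arbitrary: f v)
    case 0
    note L = pair_L2[OF 0]
    have "L2_norm N (\<lambda>s. v s + \<alpha> * K h a f s) \<le> L2_norm N v + L2_norm N (\<lambda>s. \<alpha> * K h a f s)"
      using L by (intro L2_norm_triangle L2_cmult K_L2 h a) auto
    also have "\<dots> \<le> L2_norm M f + \<bar>\<alpha>\<bar> * (E * L2_norm M f)"
      unfolding L2_norm_cmult norm_of_real pair_isometry[OF 0]
      using L by (intro add_left_mono mult_left_mono KE) auto
    finally show ?case by (simp add: algebra_simps)
  next
    case (Suc n)
    have "L2_norm N (\<lambda>s. v s + \<alpha> * K h a f s) \<le>
        (a * (1 + a ^ n * (\<bar>\<alpha>\<bar> * E)) + (1 - a)) * L2_norm M f"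
      by (rule contraction_step[OF h a _ Suc.IH Suc.prems]) (use a E in auto)
    then show ?case by (simp add: algebra_simps)
  qed
  have "(\<lambda>n. (1 + a ^ n * (\<bar>\<alpha>\<bar> * E)) * L2_norm M f) \<longlonglongrightarrow> (1 + 0 * (\<bar>\<alpha>\<bar> * E)) * L2_norm M f"
    by (intro tendsto_intros LIMSEQ_power_zero) (use a in auto)
  from LIMSEQ_le_const[OF this] show ?thesis
    using bound[OF f] by auto
qed

lemma K_bound:
  assumes h: "h \<noteq> 0" and a: "0 < a" "a < 1" and f: "pair nonreal f v"
  shows "L2_norm N (K h a f) \<le> 2 / \<bar>\<alpha>\<bar> * L2_norm M f"
proof -
  note L = pair_L2[OF f]
  have "\<bar>\<alpha>\<bar> * L2_norm N (K h a f) = L2_norm N (\<lambda>s. \<alpha> * K h a f s)"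
    unfolding L2_norm_cmult by simp
  also have "\<dots> = L2_norm N (\<lambda>s. (v s + \<alpha> * K h a f s) + (-1) * v s)"
    by simp
  also have "\<dots> \<le> L2_norm N (\<lambda>s. v s + \<alpha> * K h a f s) + L2_norm N (\<lambda>s. (-1) * v s)"
    using L by (intro L2_norm_triangle S_L2[OF f h a] L2_cmult) auto
  also have "\<dots> \<le> L2_norm M f + L2_norm M f"
    unfolding L2_norm_cmult using contraction[OF h a f] pair_isometry[OF f] by simp
  finally show ?thesis
    using \<alpha>_nz by (simp add: field_simps)
qed

section \<open>The limit h -> 0 and the extension to all square integrable functions\<close>

lemma T_op_pair:
  assumes \<epsilon>: "\<epsilon> \<noteq> 0" and f: "pair nonreal f v"
  shows "L2 N (T_op M \<epsilon> f)" "L2_norm N (T_op M \<epsilon> f) \<le> 2 / \<bar>\<alpha>\<bar> * L2_norm M f"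
proof -
  note L = pair_L2[OF f]
  \<comment> \<open>The sign of h follows that of \<epsilon>, and the 4 gives 2 h \<epsilon> =
    1/(2(n + 1)), so that a lies in [1/2, 1).\<close>
  define h where "h n = inverse (real (Suc n)) / (4 * \<epsilon>)" for n
  define a where "a n = 1 - 2 * h n * \<epsilon>" for n
  have hnz: "h n \<noteq> 0" for n using \<epsilon> by (simp add: h_def)
  have "0 < inverse (real (Suc n))" "inverse (real (Suc n)) \<le> 1" for n
    by (auto simp: field_simps)
  moreover have aeq: "a n = 1 - inverse (real (Suc n)) / 2" for n
    using \<epsilon> by (simp add: a_def h_def field_simps del: of_nat_Suc)
  ultimately have a: "0 < a n" "a n < 1" for n
    by (smt (verit) field_sum_of_halves)+
  have "(\<lambda>n. inverse (real (Suc n)) / (4 * \<epsilon>)) \<longlonglongrightarrow> 0 / (4 * \<epsilon>)"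
    by (intro tendsto_intros LIMSEQ_inverse_real_of_nat) (use \<epsilon> in simp)
  then have h0: "h \<longlonglongrightarrow> 0" by (simp add: h_def[abs_def])
  have lim: "(\<lambda>n. K (h n) (a n) f s) \<longlonglongrightarrow> - T_op M \<epsilon> f s" for s
  proof -
    have [measurable]: "f \<in> borel_measurable M" using L by (simp add: L2_def)
    have "(\<lambda>n. K (h n) (a n) f s) \<longlonglongrightarrow> (\<integral>t. - (1 / (complex_of_real s - complex_of_real t + \<i> * \<epsilon>)) * f t \<partial>M)"
      unfolding K_def
    proof (rule integral_dominated_convergence)
      show "integrable M (\<lambda>t. 1 / \<bar>\<epsilon>\<bar> * cmod (f t))" using L by simp
      show "AE t in M. (\<lambda>n. kern (h n) (a n) s t * f t) \<longlonglongrightarrow> - (1 / (complex_of_real s - complex_of_real t + \<i> * \<epsilon>)) * f t"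
        unfolding a_def by (intro AE_I2 tendsto_intros kern_tendsto \<epsilon> h0 hnz)
      show "AE t in M. cmod (kern (h n) (a n) s t * f t) \<le> 1 / \<bar>\<epsilon>\<bar> * cmod (f t)" for n
      proof (rule AE_I2)
        fix t
        have "0 < h n * \<epsilon>" using a(2)[of n] by (simp add: a_def mult.commute)
        then have "1 - a n = 2 * (\<bar>h n\<bar> * \<bar>\<epsilon>\<bar>)"
          by (simp add: a_def flip: abs_mult)
        then have "2 * \<bar>h n\<bar> / (1 - a n) = 1 / \<bar>\<epsilon>\<bar>"
          using hnz[of n] by simp
        then show "cmod (kern (h n) (a n) s t * f t) \<le> 1 / \<bar>\<epsilon>\<bar> * cmod (f t)"
          unfolding norm_mult using norm_kern_le_const[OF a[of n], of "h n" s t]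
          by (intro mult_right_mono) auto
      qed
    qed measurable
    also have "(\<integral>t. - (1 / (complex_of_real s - complex_of_real t + \<i> * \<epsilon>)) * f t \<partial>M) = - T_op M \<epsilon> f s"
      unfolding T_op_def by (simp flip: Bochner_Integration.integral_minus)
    finally show ?thesis .
  qed
  have "L2 N (K (h n) (a n) f)" for n
    using L by (intro K_L2 hnz a) auto
  note F = L2_Fatou[OF this K_bound[OF hnz a f] tendsto_const lim]
  show "L2 N (T_op M \<epsilon> f)"
    using L2_cmult[OF F(1), of "-1"] by simp
  show "L2_norm N (T_op M \<epsilon> f) \<le> 2 / \<bar>\<alpha>\<bar> * L2_norm M f"
    using F(2) L2_norm_cong[of "\<lambda>s. - T_op M \<epsilon> f s" "T_op M \<epsilon> f" N] by simp
qed

text \<open>Minimizing sequences replace the orthogonal projection onto the closed span of the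
  resolvents, so that completeness of the space is not needed.\<close>

lemma almost_projection:
  assumes f: "L2 M f" and \<delta>: "0 < \<delta>"
  obtains d v where "pair nonreal d v" "L2_norm M d \<le> 2 * L2_norm M f + \<delta>"
    "\<And>z. Im z \<noteq> 0 \<Longrightarrow>
      cmod (L2_inner M (\<lambda>t. f t - d t) (resolvent z)) \<le> \<delta> * sqrt (1 + (L2_norm M (resolvent z))\<^sup>2)"
proof -
  define S where "S = {(L2_norm M (\<lambda>t. f t - d t))\<^sup>2 | d v. pair nonreal d v}"
  define m where "m = Inf S"
  have bdd: "bdd_below S" unfolding S_def by (rule bdd_belowI[of _ 0]) auto
  have lower: "m \<le> (L2_norm M (\<lambda>t. f t - d t))\<^sup>2" if "pair nonreal d v" for d v
    unfolding m_def by (rule cInf_lower[OF _ bdd]) (use that in \<open>auto simp: S_def\<close>)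
  have "S \<noteq> {}" using res_pair.zero by (fastforce simp: S_def)
  then have "\<exists>x\<in>S. x < m + \<delta>\<^sup>2"
    using cInf_lessD[of S "m + \<delta>\<^sup>2"] \<delta> by (auto simp: m_def)
  then obtain d v where d: "pair nonreal d v"
    and less: "(L2_norm M (\<lambda>t. f t - d t))\<^sup>2 < m + \<delta>\<^sup>2"
    by (auto simp: S_def)
  define q where "q = (\<lambda>t. f t - d t)"
  have Ld: "L2 M d" using pair_L2[OF d] by simp
  then have q: "L2 M q" unfolding q_def by (rule L2_diff[OF f])
  \<comment> \<open>The zero pair is a competitor, so the infimum is at most the squared norm of
    \<open>f\<close>.\<close>
  have "(L2_norm M q)\<^sup>2 \<le> (L2_norm M f)\<^sup>2 + \<delta>\<^sup>2"
    using less lower[OF res_pair.zero] by (simp add: q_def)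
  also have "\<dots> \<le> (L2_norm M f + \<delta>)\<^sup>2"
    using \<delta> by (simp add: power2_sum)
  finally have "L2_norm M q \<le> L2_norm M f + \<delta>"
    by (rule power2_le_imp_le) (use \<delta> in simp)
  moreover have "L2_norm M (\<lambda>t. f t + (-1) * q t) \<le> L2_norm M f + L2_norm M (\<lambda>t. (-1) * q t)"
    by (intro L2_norm_triangle L2_cmult f q)
  ultimately have "L2_norm M d \<le> 2 * L2_norm M f + \<delta>"
    unfolding L2_norm_cmult by (simp add: q_def)
  moreover have "cmod (L2_inner M q (resolvent z)) \<le> \<delta> * sqrt (1 + (L2_norm M (resolvent z))\<^sup>2)"
    if z: "Im z \<noteq> 0" for z
  proof -
    define p where "p = L2_inner M q (resolvent z)"
    define A where "A = (L2_norm M (resolvent z))\<^sup>2"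
    \<comment> \<open>The quadratic in \<open>x\<close> is minimal at 1/A; 1/(1 + A) avoids a case
      distinction at A = 0 and still has x A <= 1.\<close>
    define x where "x = 1 / (1 + A)"
    have A: "0 \<le> A" by (simp add: A_def)
    define c where "c = complex_of_real x * p"
    have "pair nonreal (\<lambda>t. d t + c * resolvent z t) (\<lambda>s. v s + c * H z * resolvent z s)"
      by (rule res_pair.add[OF d]) (use z in simp)
    from lower[OF this] have "m \<le> (L2_norm M (\<lambda>t. q t - c * resolvent z t))\<^sup>2"
      by (simp add: q_def algebra_simps)
    also have "\<dots> = (L2_norm M q)\<^sup>2 - 2 * (x * (cmod p)\<^sup>2) + x\<^sup>2 * (cmod p)\<^sup>2 * A"
    proof -
      have "cnj c * p = complex_of_real (x * (cmod p)\<^sup>2)"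
        by (simp add: c_def complex_norm_square mult_ac del: of_real_power)
      then have "Re (cnj c * p) = x * (cmod p)\<^sup>2"
        by (metis Re_complex_of_real)
      moreover have "(cmod c)\<^sup>2 = x\<^sup>2 * (cmod p)\<^sup>2"
        by (simp add: c_def norm_mult power_mult_distrib)
      ultimately show ?thesis
        using L2_norm_diff_power2[OF q M.L2_resolvent[OF z], of c] by (simp add: p_def A_def)
    qed
    finally have "x * (cmod p)\<^sup>2 * (2 - x * A) \<le> \<delta>\<^sup>2"
      using less by (simp add: q_def algebra_simps power2_eq_square)
    moreover have "x * A \<le> 1" using A by (simp add: x_def)
    then have "x * (cmod p)\<^sup>2 * 1 \<le> x * (cmod p)\<^sup>2 * (2 - x * A)"
      using A by (intro mult_left_mono) (auto simp: x_def)
    ultimately have "x * (cmod p)\<^sup>2 \<le> \<delta>\<^sup>2" by simp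
    then have "(cmod p)\<^sup>2 \<le> \<delta>\<^sup>2 * (1 + A)"
      using A by (simp add: x_def pos_divide_le_eq)
    also have "\<dots> = (\<delta> * sqrt (1 + A))\<^sup>2"
      using A by (simp add: power_mult_distrib)
    finally have "cmod p \<le> \<delta> * sqrt (1 + A)"
      by (rule power2_le_imp_le) (use \<delta> A in simp)
    then show ?thesis
      by (simp add: p_def A_def)
  qed
  ultimately show thesis
    using that[OF d] by (simp add: q_def)
qed

text \<open>The approximate projections \<open>d n\<close> need not converge to \<open>f\<close>;
  only their inner products with resolvents do. Since their norms are bounded merely by 2 |f| plus
  an error, the constant of \<open>T_op_pair\<close> doubles.\<close>

lemma T_op_bound:
  assumes \<epsilon>: "\<epsilon> \<noteq> 0" and f: "L2 M f"
  shows "L2 N (T_op M \<epsilon> f)" "L2_norm N (T_op M \<epsilon> f) \<le> 4 / \<bar>\<alpha>\<bar> * L2_norm M f"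
proof -
  let ?\<delta> = "\<lambda>n. inverse (real (Suc n))"
  define P where "P n d v \<longleftrightarrow> pair nonreal d v \<and> L2_norm M d \<le> 2 * L2_norm M f + ?\<delta> n \<and>
    (\<forall>z. Im z \<noteq> 0 \<longrightarrow> cmod (L2_inner M (\<lambda>t. f t - d t) (resolvent z))
       \<le> ?\<delta> n * sqrt (1 + (L2_norm M (resolvent z))\<^sup>2))" for n d v
  have "\<exists>d v. P n d v" for n
  proof -
    have "0 < ?\<delta> n" by simp
    from f this show ?thesis
      by (rule almost_projection) (auto simp: P_def simp del: of_nat_Suc)
  qed
  then obtain d v where "\<And>n. P n (d n) (v n)" by metis
  then have d: "\<And>n. pair nonreal (d n) (v n)"
    and d_le: "\<And>n. L2_norm M (d n) \<le> 2 * L2_norm M f + ?\<delta> n"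
    and ip: "\<And>n z. Im z \<noteq> 0 \<Longrightarrow> cmod (L2_inner M (\<lambda>t. f t - d n t) (resolvent z))
       \<le> ?\<delta> n * sqrt (1 + (L2_norm M (resolvent z))\<^sup>2)"
    unfolding P_def by blast+
  have lim: "(\<lambda>n. T_op M \<epsilon> (d n) s) \<longlonglongrightarrow> T_op M \<epsilon> f s" for s
  proof -
    let ?z = "complex_of_real s - \<i> * complex_of_real \<epsilon>"
    have z: "Im ?z \<noteq> 0" using \<epsilon> by simp
    have "(\<lambda>n. L2_inner M (\<lambda>t. f t - d n t) (resolvent ?z)) \<longlonglongrightarrow> 0"
    proof (rule Lim_null_comparison)
      show "\<forall>\<^sub>F n in sequentially. cmod (L2_inner M (\<lambda>t. f t - d n t) (resolvent ?z))
          \<le> ?\<delta> n * sqrt (1 + (L2_norm M (resolvent ?z))\<^sup>2)"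
        by (intro always_eventually allI ip z)
      show "(\<lambda>n. ?\<delta> n * sqrt (1 + (L2_norm M (resolvent ?z))\<^sup>2)) \<longlonglongrightarrow> 0"
        by (rule tendsto_mult_left_zero[OF LIMSEQ_inverse_real_of_nat])
    qed
    moreover have "L2_inner M (\<lambda>t. f t - d n t) (resolvent ?z) = T_op M \<epsilon> (d n) s - T_op M \<epsilon> f s" for n
      unfolding T_op_inner using L2_inner_diff_left[OF f _ M.L2_resolvent[OF z]] pair_L2[OF d] by simp
    ultimately show ?thesis
      by (simp add: LIM_zero_iff)
  qed
  have le: "L2_norm N (T_op M \<epsilon> (d n)) \<le> 2 / \<bar>\<alpha>\<bar> * (2 * L2_norm M f + ?\<delta> n)" for n
    using T_op_pair(2)[OF \<epsilon> d] d_le by (rule order_trans[OF _ mult_left_mono]) simp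
  have B: "(\<lambda>n. 2 / \<bar>\<alpha>\<bar> * (2 * L2_norm M f + ?\<delta> n)) \<longlonglongrightarrow> 2 / \<bar>\<alpha>\<bar> * (2 * L2_norm M f + 0)"
    by (rule tendsto_mult[OF tendsto_const tendsto_add[OF tendsto_const LIMSEQ_inverse_real_of_nat]])
  note F = L2_Fatou[OF T_op_pair(1)[OF \<epsilon> d] le B lim]
  show "L2 N (T_op M \<epsilon> f)" by (rule F(1))
  show "L2_norm N (T_op M \<epsilon> f) \<le> 4 / \<bar>\<alpha>\<bar> * L2_norm M f" using F(2) by simp
qed

end

theorem theorem2p3:
  fixes \<mu> \<mu>\<alpha> :: "real measure" and \<alpha> :: real
  assumes sets_\<mu>: "sets \<mu> = sets borel"
    and nonzero: "emeasure \<mu> (space \<mu>) \<noteq> 0"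
    and growth: "(\<integral>\<^sup>+ t. ennreal (1 / (1 + \<bar>t\<bar>)) \<partial>\<mu>) < \<infinity>"
    and \<alpha>_nz: "\<alpha> \<noteq> 0"
    and pert: "is_perturbed_measure \<mu> \<alpha> \<mu>\<alpha>"
  shows "\<exists>C::real. \<forall>\<epsilon>::real. \<forall>f :: real \<Rightarrow> complex.
           \<epsilon> \<noteq> 0 \<and> f \<in> borel_measurable \<mu> \<and> (\<integral>\<^sup>+ t. ennreal ((cmod (f t))\<^sup>2) \<partial>\<mu>) < \<infinity> \<longrightarrow>
             T_op \<mu> \<epsilon> f \<in> borel_measurable \<mu>\<alpha> \<and>
             (\<integral>\<^sup>+ s. ennreal ((cmod (T_op \<mu> \<epsilon> f s))\<^sup>2) \<partial>\<mu>\<alpha>)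
               \<le> ennreal C * (\<integral>\<^sup>+ t. ennreal ((cmod (f t))\<^sup>2) \<partial>\<mu>)"
proof -
  note [measurable_cong] = sets_\<mu>
  have int: "integrable \<mu> (\<lambda>t. 1 / (1 + \<bar>t\<bar>))"
    using growth by (subst integrable_iff_bounded) auto
  have "integrable \<mu> (resolvent z)" if "Im z \<noteq> 0" for z
    by (rule Bochner_Integration.integrable_bound
        [OF integrable_mult_right[OF int, of "(1 + cmod z) / \<bar>Im z\<bar> + 1"]])
      (measurable, simp only: real_norm_def,
        intro AE_I2 order_trans[OF norm_resolvent_le_growth[OF that] abs_ge_self])
  moreover have "sets \<mu>\<alpha> = sets borel" "Im z \<noteq> 0 \<Longrightarrow> integrable \<mu>\<alpha> (resolvent z)" for z
    using pert by (auto simp: is_perturbed_measure_def resolvent_def[abs_def])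
  ultimately interpret perturbed_pair \<mu> \<mu>\<alpha> \<alpha>
    using pert sets_\<mu> nonzero \<alpha>_nz
    by unfold_locales (auto simp: is_perturbed_measure_def)
  show ?thesis
  \<comment> \<open>The constant is squared because the conclusion compares squared norms.\<close>
  proof (intro exI[of _ "(4 / \<bar>\<alpha>\<bar>)\<^sup>2"] allI impI, elim conjE)
    fix \<epsilon> :: real and f :: "real \<Rightarrow> complex"
    assume \<epsilon>: "\<epsilon> \<noteq> 0" and "f \<in> borel_measurable \<mu>" "(\<integral>\<^sup>+ t. ennreal ((cmod (f t))\<^sup>2) \<partial>\<mu>) < \<infinity>"
    then have f: "L2 \<mu> f" by (simp add: L2_nn_integral_iff)
    note T = T_op_bound[OF \<epsilon> f]
    have "(L2_norm \<mu>\<alpha> (T_op \<mu> \<epsilon> f))\<^sup>2 \<le> (4 / \<bar>\<alpha>\<bar>)\<^sup>2 * (L2_norm \<mu> f)\<^sup>2"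
      unfolding power_mult_distrib[symmetric] by (rule power_mono[OF T(2)]) simp
    then show "T_op \<mu> \<epsilon> f \<in> borel_measurable \<mu>\<alpha> \<and>
        (\<integral>\<^sup>+ s. ennreal ((cmod (T_op \<mu> \<epsilon> f s))\<^sup>2) \<partial>\<mu>\<alpha>)
          \<le> ennreal ((4 / \<bar>\<alpha>\<bar>)\<^sup>2) * (\<integral>\<^sup>+ t. ennreal ((cmod (f t))\<^sup>2) \<partial>\<mu>)"
      using T(1) f by (simp add: L2_nn_integral L2_measurable ennreal_leI flip: ennreal_mult')
  qed
qed

end
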